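(* Let $m,n,r\ge1$ be integers, $M\in\mathbb{R}^{m\times n}$, and let $f,c,\varphi:\mathbb{R}^{m\times r}\times\mathbb{R}^{r\times n}\to\mathbb{R}$ be defined by $$f(X,Y)=\|XY-M\|_F^2/2,\quad c(X,Y)=\|X^TX-YY^T\|_F^2/4,\quad \varphi(X,Y)=\|X\|_2^2-2\|XY\|_2+\|Y\|_2^2.$$ The following hold: (i) $f+c$ is coercive; (ii) for any $(X,Y)$ with $XY=M$, $\nabla c(X,Y)=0\iff X^TX=YY^T$; (iii) for any $(X,Y)$, $\varphi'\big(X,Y;-\nabla c(X,Y)\big)\le-\varphi(X,Y)^2$; (iv) for any $(X_0,Y_0)$ with $X_0Y_0=M$, the initial value problem $$(\dot X,\dot Y)=-\nabla c(X,Y),\qquad (X(0),Y(0))=(X_0,Y_0)$$ has a unique flattening global solution converging to a balanced global minimum of $f$ such that $$\frac{d}{dt}\lambda_1(\nabla^2f(X,Y))\le-\big(\lambda_1(\nabla^2f(X,Y))-2\|M\|_2\big)^2,$$ $$\forall t>0,\quad \lambda_1(\nabla^2f(X(t),Y(t)))\le2\|M\|_2+1/t.$$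
   Context: $\|\cdot\|_F$ is the Frobenius norm, $\|\cdot\|_2$ the spectral norm, $\lambda_1(\cdot)$ the largest eigenvalue of a symmetric matrix. The space $\mathbb{R}^{m\times r}\times\mathbb{R}^{r\times n}$ carries the Euclidean structure with norm $\sqrt{\|H\|_F^2+\|K\|_F^2}$. $\varphi'(x;w)=\lim_{\tau\searrow0}(\varphi(x+\tau w)-\varphi(x))/\tau$ is the one-sided directional derivative, with $x=(X,Y)$. Coercive means tending to $\infty$ as the norm of the argument tends to $\infty$. A pair $(X,Y)$ is balanced if $X^TX=YY^T$. A solution of the initial value problem is global if it is defined on $[0,\infty)$; convergence is as $t\to\infty$. With $\mathring f(x,\rho)=\sup_{y\in\overline B_\rho(x)}|f(y)-f(x)|$ ($\overline B_\rho(x)$ the closed ball of center $x$ and radius $\rho$), write $x\preceq y$ iff there exists $\overline\rho>0$ such that $\mathring f(x,\rho)\le\mathring f(y,\rho)$ for all $\rho\in(0,\overline\rho]$. A curve $x$ defined on an interval $I$ of $\mathbb{R}$ is flattening (with respect to $f$) if $x(t)\preceq x(s)$ for all $s,t\in I$ with $s<t$.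
   Formalization: Along the flow λ₁(∇²f) can have kinks where d/dt does not exist, so the differential inequality is stated for the right derivative at every t ≥ 0, and for the two-sided derivative (shown to exist) at almost every t > 0. *)

theory Defs
  imports "HOL-Analysis.Analysis"
begin

(* R^(m x r) x R^(r x n) is the type (real^'r^'m) * (real^'n^'r). The norm of the vector type
   is, on matrices, the Frobenius norm, and the product norm is sqrt (|H|^2 + |K|^2). *)

definition spectral_norm :: "real^'n^'m \<Rightarrow> real" where
  "spectral_norm A = onorm (\<lambda>v. A *v v)"

definition mf_f :: "real^'n^'m \<Rightarrow> (real^'r^'m) \<times> (real^'n^'r) \<Rightarrow> real" where
  "mf_f M = (\<lambda>(X, Y). (norm (X ** Y - M))\<^sup>2 / 2)"

definition mf_c :: "(real^'r^'m) \<times> (real^'n^'r) \<Rightarrow> real" where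
  "mf_c = (\<lambda>(X, Y). (norm (transpose X ** X - Y ** transpose Y))\<^sup>2 / 4)"

definition mf_phi :: "(real^'r^'m) \<times> (real^'n^'r) \<Rightarrow> real" where
  "mf_phi = (\<lambda>(X, Y).
     (spectral_norm X)\<^sup>2 - 2 * spectral_norm (X ** Y) + (spectral_norm Y)\<^sup>2)"

definition balanced :: "(real^'r^'m) \<times> (real^'n^'r) \<Rightarrow> bool" where
  "balanced = (\<lambda>(X, Y). transpose X ** X = Y ** transpose Y)"

definition coercive :: "('a::real_normed_vector \<Rightarrow> real) \<Rightarrow> bool" where
  "coercive f \<longleftrightarrow> filterlim f at_top at_infinity"

definition grad :: "('a::real_inner \<Rightarrow> real) \<Rightarrow> 'a \<Rightarrow> 'a" where
  "grad f x = (THE g. GDERIV f x :> g)"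

(* The Hessian as a linear operator, the derivative of the gradient map; in an orthonormal basis
   its matrix is the usual Hessian matrix. *)
definition hessian :: "('a::euclidean_space \<Rightarrow> real) \<Rightarrow> 'a \<Rightarrow> 'a \<Rightarrow> 'a" where
  "hessian f x = frechet_derivative (grad f) (at x)"

definition is_eigenvalue :: "('a::real_vector \<Rightarrow> 'a) \<Rightarrow> real \<Rightarrow> bool" where
  "is_eigenvalue T l \<longleftrightarrow> (\<exists>v. v \<noteq> 0 \<and> T v = l *\<^sub>R v)"

(* Meaningful for self-adjoint linear operators in finite dimension. *)
definition lambda1 :: "('a::real_vector \<Rightarrow> 'a) \<Rightarrow> real" where
  "lambda1 T = (GREATEST l. is_eigenvalue T l)"

(* d is the one-sided directional derivative of f at x along w; existence of the limit is part of
   the predicate. *)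
definition has_dir_deriv :: "('a::real_normed_vector \<Rightarrow> real) \<Rightarrow> 'a \<Rightarrow> 'a \<Rightarrow> real \<Rightarrow> bool" where
  "has_dir_deriv f x w d \<longleftrightarrow>
     ((\<lambda>\<tau>. (f (x + \<tau> *\<^sub>R w) - f x) / \<tau>) \<longlongrightarrow> d) (at_right 0)"

definition ball_variation :: "('a::metric_space \<Rightarrow> real) \<Rightarrow> 'a \<Rightarrow> real \<Rightarrow> real" where
  "ball_variation f x \<rho> = (SUP y\<in>cball x \<rho>. \<bar>f y - f x\<bar>)"

definition flatter_eq :: "('a::metric_space \<Rightarrow> real) \<Rightarrow> 'a \<Rightarrow> 'a \<Rightarrow> bool" where
  "flatter_eq f x y \<longleftrightarrow>
     (\<exists>\<rho>'>0. \<forall>\<rho>\<in>{0<..\<rho>'}. ball_variation f x \<rho> \<le> ball_variation f y \<rho>)"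

definition flattening_on :: "('a::metric_space \<Rightarrow> real) \<Rightarrow> real set \<Rightarrow> (real \<Rightarrow> 'a) \<Rightarrow> bool" where
  "flattening_on f I x \<longleftrightarrow> (\<forall>s\<in>I. \<forall>t\<in>I. s < t \<longrightarrow> flatter_eq f (x t) (x s))"

(* Only the values of x on [0,\<infinity>) matter. *)
definition global_solution ::
  "('a::real_normed_vector \<Rightarrow> 'a) \<Rightarrow> 'a \<Rightarrow> (real \<Rightarrow> 'a) \<Rightarrow> bool" where
  "global_solution v x0 x \<longleftrightarrow>
     x 0 = x0 \<and> (\<forall>t\<ge>0. (x has_vector_derivative v (x t)) (at t within {0..}))"

end

theory Submission
  imports Defs
begin

text \<open>
  Write \<open>D = X\<^sup>T X - Y Y\<^sup>T\<close>. Then \<open>\<nabla>c(X, Y) = (X D, - D Y)\<close>, so the flow preserves \<open>X Y\<close> and does not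
  increase the norm, because \<open>\<langle>z, \<nabla>c(z)\<rangle> = |D|\<^sup>2\<close>; hence it is global. A top eigenvector of \<open>D\<close> gives
  \<open>|\<nabla>c|\<^sup>2 \<ge> |D|\<^sub>2 ^ 3\<close>, a Lojasiewicz inequality with exponent \<open>3/4\<close>, so trajectories have finite length
  and their limits are critical, that is, balanced. On the fibre \<open>X Y = M\<close> the Hessian form of \<open>f\<close> is
  \<open>|H Y + X K|\<^sup>2\<close>, and its largest eigenvalue is the convex function \<open>|X|\<^sub>2\<^sup>2 + |Y|\<^sub>2\<^sup>2 = \<phi> + 2 |M|\<^sub>2\<close>. Along
  the flow it has one-sided derivatives bounded by \<open>- \<phi>\<^sup>2\<close>, which agree off a countable set. The flow is
  flattening because either \<open>\<phi> > 0\<close> and the eigenvalue strictly decreases, or \<open>\<phi> = 0\<close> and the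
  variation of \<open>f\<close> on small balls depends only on the eigenvalue.
\<close>

text \<open>The obstacle is that the largest eigenvalue can fail to be differentiable where a top
  singular value is multiple. The monotonicity claims along the flow are therefore reduced to one
  criterion, \<open>right_derivative_nonpos_imp_le\<close>, for continuous functions with
  nonpositive right derivatives. Convexity supplies the derivatives, and a quadratic upper bound
  along an explicit Euler step supplies their sign. The exponent 3/4 comes from degrees: c is
  quadratic in D, so |D|_2^(3/2) is comparable to c^(3/4). A merely nonincreasing eigenvalue would
  not give flattening. On a ball of radius rho the variation of f is (l rho + O(rho^2))^2 / 2 with
  l^2 the eigenvalue, so a tie leaves the O(rho^2) terms undecided. The inequality phi' \<le> -
  phi^2 excludes ties except at phi = 0, where the eigenvalue sits at its lower bound 2 |M|_2 on the
  fibre and the O(rho^2) term is exactly rho^2 / 2.\<close>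

section \<open>Spectral norm and singular vectors\<close>

text \<open>As simp rules these rewrite \<open>transpose A *v x\<close> to \<open>x v* A\<close>,
  which would hide the adjoint form used throughout.\<close>

lemmas [simp del] = transpose_matrix_vector vector_transpose_matrix

lemma bounded_bilinear_matrix_mul:
  "bounded_bilinear ((**) :: real^'b^'a \<Rightarrow> real^'c^'b \<Rightarrow> real^'c^'a)"
  unfolding bilinear_conv_bounded_bilinear[symmetric] bilinear_def
  by (auto intro!: linearI simp: matrix_matrix_mult_def vec_eq_iff sum.distrib sum_distrib_left algebra_simps)

lemma bounded_linear_transpose:
  "bounded_linear (transpose :: real^'b^'a \<Rightarrow> real^'a^'b)"
  unfolding linear_conv_bounded_linear[symmetric]
  by (auto intro!: linearI simp: transpose_def vec_eq_iff)

interpretation mul: bounded_bilinear "(**) :: real^'b^'a \<Rightarrow> real^'c^'b \<Rightarrow> real^'c^'a"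
  by (rule bounded_bilinear_matrix_mul)

lemma transpose_diff: "transpose (A - B) = transpose A - transpose (B :: real^'b^'a)"
  and transpose_0: "transpose (0 :: real^'b^'a) = 0"
  by (simp_all add: transpose_def vec_eq_iff)

text \<open>Moves a factor across the Frobenius inner product. With its right-hand counterpart it
  turns the derivatives of c and f into gradients.\<close>

lemma inner_matrix_mul_left:
  fixes A :: "real^'b^'a" and B :: "real^'c^'b" and C :: "real^'c^'a"
  shows "(A ** B) \<bullet> C = B \<bullet> (transpose A ** C)"
proof -
  have "(A ** B) \<bullet> C = (\<Sum>i\<in>UNIV. \<Sum>j\<in>UNIV. \<Sum>k\<in>UNIV. A$i$k * B$k$j * C$i$j)"
    by (simp add: inner_vec_def matrix_matrix_mult_def sum_distrib_right)
  also have "\<dots> = (\<Sum>i\<in>UNIV. \<Sum>k\<in>UNIV. \<Sum>j\<in>UNIV. A$i$k * B$k$j * C$i$j)"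
    by (intro sum.cong refl sum.swap)
  also have "\<dots> = (\<Sum>k\<in>UNIV. \<Sum>i\<in>UNIV. \<Sum>j\<in>UNIV. A$i$k * B$k$j * C$i$j)"
    by (rule sum.swap)
  also have "\<dots> = (\<Sum>k\<in>UNIV. \<Sum>j\<in>UNIV. \<Sum>i\<in>UNIV. A$i$k * B$k$j * C$i$j)"
    by (intro sum.cong refl sum.swap)
  also have "\<dots> = B \<bullet> (transpose A ** C)"
    by (simp add: inner_vec_def matrix_matrix_mult_def sum_distrib_left transpose_def mult_ac)
  finally show ?thesis .
qed

lemma inner_transpose [simp]:
  fixes A B :: "real^'b^'a"
  shows "transpose A \<bullet> transpose B = A \<bullet> B"
  by (simp add: inner_vec_def transpose_def) (rule sum.swap)

lemma norm_transpose [simp]: "norm (transpose (A :: real^'b^'a)) = norm A"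
  by (simp add: norm_eq_sqrt_inner)

lemma inner_matrix_mul_right:
  fixes A :: "real^'b^'a" and B :: "real^'c^'b" and C :: "real^'c^'a"
  shows "(A ** B) \<bullet> C = A \<bullet> (C ** transpose B)"
proof -
  have "(A ** B) \<bullet> C = (transpose B ** transpose A) \<bullet> transpose C"
    by (simp flip: matrix_transpose_mul)
  also have "\<dots> = transpose A \<bullet> (B ** transpose C)"
    by (simp add: inner_matrix_mul_left)
  also have "\<dots> = transpose A \<bullet> transpose (C ** transpose B)"
    by (simp add: matrix_transpose_mul)
  finally show ?thesis by simp
qed

lemma inner_matrix_vector:
  fixes A :: "real^'b^'a"
  shows "(A *v x) \<bullet> y = x \<bullet> (transpose A *v y)"
  by (metis dot_lmul_matrix inner_commute transpose_matrix_vector)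

lemma bounded_linear_matrix_vector: "bounded_linear ((*v) (A :: real^'b^'a))"
  by (simp add: matrix_vector_mul_bounded_linear)

lemma norm_matrix_vector: "norm (A *v u) \<le> spectral_norm A * norm (u :: real^'b)"
  unfolding spectral_norm_def by (intro onorm bounded_linear_matrix_vector)

lemma spectral_norm_le: "(\<And>u. norm (A *v u) \<le> b * norm u) \<Longrightarrow> spectral_norm (A :: real^'b^'a) \<le> b"
  unfolding spectral_norm_def by (intro onorm_le)

lemma spectral_norm_nonneg: "0 \<le> spectral_norm (A :: real^'b^'a)"
  unfolding spectral_norm_def by (intro onorm_pos_le bounded_linear_matrix_vector)

lemma spectral_norm_le_unit:
  fixes A :: "real^'b^'a"
  assumes "\<And>u. norm u = 1 \<Longrightarrow> norm (A *v u) \<le> b"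
  shows "spectral_norm A \<le> b"
proof (rule spectral_norm_le)
  fix u :: "real^'b"
  show "norm (A *v u) \<le> b * norm u"
  proof (cases "u = 0")
    case False
    then have "norm (A *v (u /\<^sub>R norm u)) \<le> b" by (intro assms) simp
    then show ?thesis using False by (simp add: matrix_vector_mult_scaleR field_simps)
  qed simp
qed

text \<open>Cancelling \<open>norm (transpose A *v u)\<close> from |A^T u|^2 = <A A^T u, u> \<le>
  |A|_2 |A^T u| |u| gives one inequality; applying it to the transpose gives the other.\<close>

lemma spectral_norm_transpose [simp]: "spectral_norm (transpose A) = spectral_norm (A :: real^'b^'a)"
proof -
  have *: "spectral_norm (transpose A) \<le> spectral_norm A" for A :: "real^'x^'y"
  proof (rule spectral_norm_le)
    fix u
    have "(norm (transpose A *v u))\<^sup>2 = (A *v (transpose A *v u)) \<bullet> u"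
      by (simp add: power2_norm_eq_inner inner_matrix_vector)
    also have "\<dots> \<le> norm (A *v (transpose A *v u)) * norm u" by (rule norm_cauchy_schwarz)
    also have "\<dots> \<le> (spectral_norm A * norm (transpose A *v u)) * norm u"
      by (intro mult_right_mono norm_matrix_vector) simp
    finally have "norm (transpose A *v u) * norm (transpose A *v u) \<le> norm (transpose A *v u) * (spectral_norm A * norm u)"
      by (simp add: power2_eq_square mult_ac)
    then show "norm (transpose A *v u) \<le> spectral_norm A * norm u"
      by (cases "norm (transpose A *v u) = 0") (auto simp: spectral_norm_nonneg)
  qed
  show ?thesis using *[of A] *[of "transpose A"] by simp
qed

lemma spectral_norm_mul_le:
  fixes A :: "real^'b^'a" and B :: "real^'c^'b"
  shows "spectral_norm (A ** B) \<le> spectral_norm A * spectral_norm B"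
proof (rule spectral_norm_le)
  fix u
  have "norm ((A ** B) *v u) \<le> spectral_norm A * norm (B *v u)"
    by (simp flip: matrix_vector_mul_assoc add: norm_matrix_vector)
  also have "\<dots> \<le> spectral_norm A * (spectral_norm B * norm u)"
    by (intro mult_left_mono norm_matrix_vector spectral_norm_nonneg)
  finally show "norm ((A ** B) *v u) \<le> spectral_norm A * spectral_norm B * norm u"
    by (simp add: mult_ac)
qed

lemma spectral_norm_triangle:
  "spectral_norm (A + B) \<le> spectral_norm A + spectral_norm (B :: real^'b^'a)"
  unfolding spectral_norm_def matrix_vector_mult_add_rdistrib
  by (intro onorm_triangle bounded_linear_matrix_vector)

lemma spectral_norm_scaleR: "spectral_norm (r *\<^sub>R A) = \<bar>r\<bar> * spectral_norm (A :: real^'b^'a)"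
  unfolding spectral_norm_def scaleR_matrix_vector_assoc[symmetric]
  by (intro onorm_scaleR bounded_linear_matrix_vector)

lemma norm_sq_matrix: "(norm (A :: real^'b^'a))\<^sup>2 = (\<Sum>i\<in>UNIV. (norm (A $ i))\<^sup>2)"
  by (simp add: power2_norm_eq_inner inner_vec_def)

text \<open>The columns of \<open>A ** B\<close> are the images under \<open>A\<close> of the
  columns of \<open>B\<close>, and squared Frobenius norms add over columns. The transpose enters
  because \<open>norm_sq_matrix\<close> sums over rows.\<close>

lemma norm_matrix_mul_left:
  fixes A :: "real^'b^'a" and B :: "real^'c^'b"
  shows "norm (A ** B) \<le> spectral_norm A * norm B"
proof -
  have row: "transpose (A ** B) $ j = A *v (transpose B $ j)" for j
    by (simp add: transpose_def matrix_matrix_mult_def matrix_vector_mult_def vec_eq_iff)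
  have "(norm (A ** B))\<^sup>2 = (norm (transpose (A ** B)))\<^sup>2" by simp
  also have "\<dots> = (\<Sum>j\<in>UNIV. (norm (A *v (transpose B $ j)))\<^sup>2)"
    by (simp only: norm_sq_matrix row)
  also have "\<dots> \<le> (\<Sum>j\<in>UNIV. (spectral_norm A * norm (transpose B $ j))\<^sup>2)"
    by (intro sum_mono power_mono norm_matrix_vector) simp
  also have "\<dots> = (spectral_norm A)\<^sup>2 * (norm (transpose B))\<^sup>2"
    by (simp only: norm_sq_matrix power_mult_distrib sum_distrib_left)
  finally have "(norm (A ** B))\<^sup>2 \<le> (spectral_norm A * norm B)\<^sup>2"
    by (simp add: power_mult_distrib)
  then show ?thesis by (rule power2_le_imp_le) (simp add: spectral_norm_nonneg)
qed

lemma norm_matrix_mul_right: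
  fixes A :: "real^'b^'a" and B :: "real^'c^'b"
  shows "norm (A ** B) \<le> norm A * spectral_norm B"
  using norm_matrix_mul_left[of "transpose B" "transpose A"]
  by (simp flip: matrix_transpose_mul add: mult_ac)

lemma norm_matrix_vector_frobenius: "norm (A *v u) \<le> norm (A :: real^'b^'a) * norm u"
proof -
  have "(norm (A *v u))\<^sup>2 = (\<Sum>i\<in>UNIV. (A $ i \<bullet> u)\<^sup>2)"
    unfolding power2_norm_eq_inner by (simp add: inner_vec_def matrix_vector_mult_def power2_eq_square)
  also have "\<dots> \<le> (\<Sum>i\<in>UNIV. (norm (A $ i))\<^sup>2 * (norm u)\<^sup>2)"
    by (intro sum_mono) (metis Cauchy_Schwarz_ineq power2_norm_eq_inner)
  also have "\<dots> = (norm A * norm u)\<^sup>2"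
    by (simp add: norm_sq_matrix power_mult_distrib sum_distrib_right)
  finally show ?thesis by (rule power2_le_imp_le) simp
qed

lemma spectral_norm_le_norm: "spectral_norm A \<le> norm (A :: real^'b^'a)"
  by (intro spectral_norm_le norm_matrix_vector_frobenius)

lemma norm_matrix_mul: 
  fixes A :: "real^'b^'a" and B :: "real^'c^'b"
  shows "norm (A ** B) \<le> norm A * norm B"
  using norm_matrix_mul_left[of A B] mult_right_mono[OF spectral_norm_le_norm[of A], of "norm B"]
  by simp

text \<open>Each of the \<open>CARD('a)\<close> rows is the image of a unit vector under the
  transpose. The factor reappears in the Lojasiewicz constant.\<close>

lemma norm_le_spectral_norm: "norm (A :: real^'b^'a) \<le> sqrt CARD('a) * spectral_norm A"
proof -
  have "norm (A $ i) \<le> spectral_norm A" for i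
  proof -
    have "A $ i = transpose A *v axis i 1"
      by (simp add: matrix_vector_mult_def vec_eq_iff transpose_def axis_def if_distrib cong: if_cong)
    then show ?thesis
      using norm_matrix_vector[of "transpose A" "axis i 1"] by simp
  qed
  then have "(norm A)\<^sup>2 \<le> (\<Sum>i\<in>(UNIV :: 'a set). (spectral_norm A)\<^sup>2)"
    unfolding norm_sq_matrix by (intro sum_mono power_mono) auto
  also have "\<dots> = (sqrt CARD('a) * spectral_norm A)\<^sup>2"
    by (simp add: power_mult_distrib)
  finally show ?thesis by (rule power2_le_imp_le) (simp add: spectral_norm_nonneg)
qed

lemma spectral_norm_attained:
  fixes A :: "real^'b^'a"
  obtains u where "norm u = 1" "norm (A *v u) = spectral_norm A"
proof -
  have ne: "sphere (0 :: real^'b) 1 \<noteq> {}"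
    by (metis mem_sphere_0 empty_iff norm_axis_1)
  have "continuous_on (sphere 0 1) (\<lambda>v. norm (A *v v))"
    by (intro continuous_on_norm linear_continuous_on bounded_linear_matrix_vector)
  from continuous_attains_sup[OF compact_sphere ne this]
  obtain u where u: "u \<in> sphere 0 1" "\<And>v. v \<in> sphere 0 1 \<Longrightarrow> norm (A *v v) \<le> norm (A *v u)"
    by blast
  have "spectral_norm A \<le> norm (A *v u)"
    by (rule spectral_norm_le_unit) (use u in auto)
  with norm_matrix_vector[of A u] u that show ?thesis by auto
qed

text \<open>With s = |A|_2 and w = A^T A u, the squared distance from w to s^2 u expands to |w|^2 -
  s^4, which |w| \<le> s^2 makes nonpositive.\<close>

lemma singular_vector:
  fixes A :: "real^'b^'a"
  assumes "norm u = 1" "norm (A *v u) = spectral_norm A"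
  shows "transpose A *v (A *v u) = (spectral_norm A)\<^sup>2 *\<^sub>R u"
proof -
  let ?s = "spectral_norm A" and ?w = "transpose A *v (A *v u)"
  have "(norm (?w - ?s\<^sup>2 *\<^sub>R u))\<^sup>2 = (norm ?w)\<^sup>2 - 2 * ?s\<^sup>2 * (u \<bullet> ?w) + ?s^4 * (norm u)\<^sup>2"
    unfolding power2_norm_eq_inner
    by (simp add: inner_diff inner_commute power4_eq_xxxx algebra_simps power2_eq_square)
  also have "u \<bullet> ?w = ?s\<^sup>2"
    by (simp add: assms flip: inner_matrix_vector power2_norm_eq_inner)
  also have "(norm ?w)\<^sup>2 \<le> (?s * ?s)\<^sup>2"
    using norm_matrix_vector[of "transpose A" "A *v u"] assms by (intro power_mono) auto
  finally have "(norm (?w - ?s\<^sup>2 *\<^sub>R u))\<^sup>2 \<le> 0"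
    by (simp add: assms power4_eq_xxxx power2_eq_square)
  then show ?thesis by simp
qed

lemma singular_pair:
  fixes A :: "real^'b^'a"
  assumes "norm u = 1" "norm (A *v u) = spectral_norm A"
  obtains v where "norm v = 1" "A *v u = spectral_norm A *\<^sub>R v" "transpose A *v v = spectral_norm A *\<^sub>R u"
proof (cases "spectral_norm A = 0")
  case True
  then have "A *v w = 0" "transpose A *v x = 0" for w x
    using norm_matrix_vector[of A w] norm_matrix_vector[of "transpose A" x] by auto
  \<comment> \<open>A zero matrix accepts any unit vector as \<open>v\<close>.\<close>
  then show ?thesis using that[of "axis undefined 1"] True by simp
next
  case False
  with assms have "norm (A *v u /\<^sub>R spectral_norm A) = 1" 
    using spectral_norm_nonneg[of A] by simp
  then show ?thesis
    using that[of "A *v u /\<^sub>R spectral_norm A"] False singular_vector[OF assms]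
    by (simp add: matrix_vector_mult_scaleR power2_eq_square)
qed

text \<open>A norm-attaining u satisfies (D - d)(D + d) u = 0 with d = |D|_2. Either (D + d) u
  vanishes and u belongs to -d, or it is an eigenvector for d.\<close>

lemma symmetric_extreme_eigenvector:
  fixes D :: "real^'a^'a"
  assumes "transpose D = D"
  obtains u l where "norm u = 1" "D *v u = l *\<^sub>R u" "\<bar>l\<bar> = spectral_norm D"
proof -
  let ?d = "spectral_norm D"
  obtain u where u: "norm u = 1" "norm (D *v u) = ?d" by (rule spectral_norm_attained)
  have sq: "D *v (D *v u) = ?d\<^sup>2 *\<^sub>R u" using singular_vector[OF u] assms by simp
  define w where "w = D *v u + ?d *\<^sub>R u"
  show thesis
  proof (cases "w = 0")
    case True
    then have "D *v u = (- ?d) *\<^sub>R u" by (simp add: w_def add_eq_0_iff2)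
    with u that[of u "- ?d"] spectral_norm_nonneg[of D] show ?thesis by simp
  next
    case False
    have "D *v w = ?d *\<^sub>R w"
      by (simp add: w_def matrix_vector_right_distrib matrix_vector_mult_scaleR sq power2_eq_square algebra_simps)
    then show ?thesis
      using that[of "w /\<^sub>R norm w" ?d] False spectral_norm_nonneg[of D]
      by (simp add: matrix_vector_mult_scaleR)
  qed
qed

section \<open>Rank-one matrices\<close>

definition outer :: "real^'a \<Rightarrow> real^'b \<Rightarrow> real^'b^'a" where
  "outer u v = (\<chi> i j. u $ i * v $ j)"

lemma matrix_mul_outer: "A ** outer u v = outer (A *v u) v"
  by (simp add: outer_def matrix_matrix_mult_def matrix_vector_mult_def vec_eq_iff sum_distrib_left mult_ac)

lemma outer_matrix_mul: "outer u v ** A = outer u (transpose A *v v)"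
  by (simp add: outer_def matrix_matrix_mult_def matrix_vector_mult_def vec_eq_iff sum_distrib_left transpose_def mult_ac)

lemma transpose_outer: "transpose (outer u v) = outer v u"
  by (simp add: outer_def transpose_def vec_eq_iff mult_ac)

lemma outer_vector: "outer u v *v w = (v \<bullet> w) *\<^sub>R u"
  by (simp add: outer_def matrix_vector_mult_def vec_eq_iff inner_vec_def sum_distrib_left mult_ac)

lemma outer_scaleR_left: "outer (r *\<^sub>R u) v = r *\<^sub>R outer u v"
  and outer_scaleR_right: "outer u (r *\<^sub>R v) = r *\<^sub>R outer u v"
  by (simp_all add: outer_def vec_eq_iff)

lemma norm_outer: "norm (outer u v) = norm u * norm v"
proof -
  have "(outer u v) $ i = u $ i *\<^sub>R v" for i by (simp add: outer_def vec_eq_iff)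
  then have "(norm (outer u v))\<^sup>2 = (\<Sum>i\<in>UNIV. (norm (u $ i *\<^sub>R v))\<^sup>2)"
    by (simp add: norm_sq_matrix)
  also have "\<dots> = (\<Sum>i\<in>UNIV. (u $ i)\<^sup>2) * (norm v)\<^sup>2"
    by (simp add: power_mult_distrib sum_distrib_right)
  also have "(\<Sum>i\<in>UNIV. (u $ i)\<^sup>2) = (norm u)\<^sup>2"
    unfolding power2_norm_eq_inner by (simp add: inner_vec_def power2_eq_square)
  finally have "(norm (outer u v))\<^sup>2 = (norm u * norm v)\<^sup>2" by (simp add: power_mult_distrib)
  then show ?thesis by (metis norm_ge_zero mult_nonneg_nonneg power2_eq_iff_nonneg)
qed

section \<open>One-sided derivatives\<close>

text \<open>If g rose from a to b, subtracting a line of smaller positive slope would leave a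
  function h with h a = 0 < h b. At the last point where h \<le> 0 its right derivative is negative,
  so h stays negative just after it, a contradiction.\<close>

lemma right_derivative_nonpos_imp_le:
  fixes g :: "real \<Rightarrow> real"
  assumes "a \<le> b" and cont: "continuous_on {a..b} g"
    and der: "\<And>t. a \<le> t \<Longrightarrow> t < b \<Longrightarrow> \<exists>d\<le>0. (g has_real_derivative d) (at_right t)"
  shows "g b \<le> g a"
proof (rule ccontr)
  assume "\<not> ?thesis"
  then have gt: "g a < g b" by simp
  then have "a < b" using \<open>a \<le> b\<close> by (cases "a = b") auto
  \<comment> \<open>Half of the mean slope, so that \<open>h b\<close> is still half of the
    rise.\<close>
  define e where "e = (g b - g a) / 2 / (b - a)"
  have "e > 0" using gt \<open>a < b\<close> by (simp add: e_def)
  define h where "h s = g s - g a - e * (s - a)" for s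
  have "e * (b - a) = (g b - g a) / 2"
    using nonzero_eq_divide_eq[of "b - a" e "(g b - g a) / 2"] \<open>a < b\<close> e_def by linarith
  then have hb: "h b > 0" using gt by (simp add: h_def)
  define S where "S = {s \<in> {a..b}. h s \<le> 0}"
  have "continuous_on {a..b} h" unfolding h_def by (intro continuous_intros cont)
  then have "closed S"
    unfolding S_def by (intro continuous_closed_preimage_constant continuous_on_closed_Collect_le) auto
  moreover have "a \<in> S" using \<open>a < b\<close> by (simp add: S_def h_def)
  moreover have bdd: "bdd_above S" by (auto simp: S_def)
  ultimately have sup: "Sup S \<in> S" using closed_contains_Sup by blast
  define c where "c = Sup S"
  have c: "a \<le> c" "c \<le> b" "h c \<le> 0" using sup by (auto simp: S_def c_def)
  then have "c < b" using hb by (cases "c = b") auto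
  have pos: "h s > 0" if "c < s" "s \<le> b" for s
    using that c cSup_upper[OF _ bdd, of s] by (force simp: S_def c_def)
  from der[OF c(1) \<open>c < b\<close>] obtain d where "d \<le> 0" "(g has_real_derivative d) (at_right c)" by blast
  then have "(h has_real_derivative d - e) (at_right c)"
    unfolding h_def by (auto intro!: derivative_eq_intros)
  from has_real_derivative_neg_dec_right[OF this] \<open>d \<le> 0\<close> \<open>e > 0\<close>
  obtain \<delta> where \<delta>: "\<delta> > 0" "\<And>k. 0 < k \<Longrightarrow> k < \<delta> \<Longrightarrow> h (c + k) < h c" by auto
  let ?k = "min (\<delta> / 2) (b - c)"
  have "h (c + ?k) < h c" by (rule \<delta>(2)) (use \<delta>(1) \<open>c < b\<close> in auto)
  moreover have "h (c + ?k) > 0" by (rule pos) (use \<delta>(1) \<open>c < b\<close> in auto)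
  ultimately show False using c by simp
qed

text \<open>At a corner with \<open>l < q < r\<close> the function \<open>s \<mapsto> g s - q * s\<close> has a strict local
  minimum, and a strict minimum over a rational interval determines the point.\<close>

lemma countable_convex_corners:
  fixes g :: "real \<Rightarrow> real"
  shows "countable {t. \<exists>l r. (g has_real_derivative l) (at_left t) \<and>
    (g has_real_derivative r) (at_right t) \<and> l < r}" (is "countable ?C")
proof -
  define T where "T = (\<lambda>(q, a, b). {t. a < t \<and> t < b \<and>
    (\<forall>s. a < s \<longrightarrow> s < b \<longrightarrow> s \<noteq> t \<longrightarrow> g t - q * t < g s - q * s)})"
  have "?C \<subseteq> (\<Union>p \<in> \<rat> \<times> \<rat> \<times> \<rat>. T p)"
  proof
    fix t assume "t \<in> ?C"
    then obtain l r where l: "(g has_real_derivative l) (at_left t)"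
      and r: "(g has_real_derivative r) (at_right t)" and "l < r" by blast
    obtain q where q: "q \<in> \<rat>" "l < q" "q < r" using Rats_dense_in_real[OF \<open>l < r\<close>] by blast
    have "((\<lambda>s. g s - q * s) has_real_derivative l - q) (at_left t)"
      by (auto intro!: derivative_eq_intros l)
    from has_real_derivative_neg_dec_left[OF this] q obtain \<delta>1 where
      \<delta>1: "\<delta>1 > 0" "\<And>k. 0 < k \<Longrightarrow> k < \<delta>1 \<Longrightarrow> g t - q * t < g (t - k) - q * (t - k)" by auto
    have "((\<lambda>s. g s - q * s) has_real_derivative r - q) (at_right t)"
      by (auto intro!: derivative_eq_intros r)
    from has_real_derivative_pos_inc_right[OF this] q obtain \<delta>2 where
      \<delta>2: "\<delta>2 > 0" "\<And>k. 0 < k \<Longrightarrow> k < \<delta>2 \<Longrightarrow> g t - q * t < g (t + k) - q * (t + k)" by auto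
    obtain a where a: "a \<in> \<rat>" "t - \<delta>1 < a" "a < t" using Rats_dense_in_real[of "t - \<delta>1" t] \<delta>1 by auto
    obtain b where b: "b \<in> \<rat>" "t < b" "b < t + \<delta>2" using Rats_dense_in_real[of t "t + \<delta>2"] \<delta>2 by auto
    have "g t - q * t < g s - q * s" if "a < s" "s < b" "s \<noteq> t" for s
      using \<delta>1(2)[of "t - s"] \<delta>2(2)[of "s - t"] that a b by (cases "s < t") auto
    then have "t \<in> T (q, a, b)" using a b by (auto simp: T_def)
    then show "t \<in> (\<Union>p \<in> \<rat> \<times> \<rat> \<times> \<rat>. T p)" using q a b by blast
  qed
  moreover have "countable (T p)" for p
  proof -
    obtain q a b where p: "p = (q, a, b)" by (cases p)
    have "s = t" if "s \<in> T p" "t \<in> T p" for s t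
      using that unfolding T_def p by (metis (mono_tags, lifting) case_prod_conv less_asym mem_Collect_eq)
    then have "T p \<subseteq> {SOME t. t \<in> T p}" by (metis singletonI someI subsetI)
    then show ?thesis by (meson countable_empty countable_insert countable_subset)
  qed
  ultimately show ?thesis
    by (meson countable_SIGMA countable_UN countable_rat countable_subset)
qed

lemma has_real_derivative_of_one_sided:
  assumes "(g has_real_derivative d) (at_left t)" "(g has_real_derivative d) (at_right t)"
  shows "(g has_real_derivative d) (at t)"
  using assms unfolding has_field_derivative_iff by (rule filterlim_split_at)

text \<open>Corners with l < r are covered by \<open>g\<close>, those with l > r by
  \<open>- g\<close>.\<close>

lemma countable_one_sided_not_differentiable:
  fixes g :: "real \<Rightarrow> real"
  shows "countable {t. (\<exists>l. (g has_real_derivative l) (at_left t)) \<and>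
    (\<exists>r. (g has_real_derivative r) (at_right t)) \<and> \<not> (\<exists>d. (g has_real_derivative d) (at t))}"
proof (rule countable_subset)
  let ?C = "\<lambda>g :: real \<Rightarrow> real. {t. \<exists>l r. (g has_real_derivative l) (at_left t) \<and>
    (g has_real_derivative r) (at_right t) \<and> l < r}"
  show "countable (?C g \<union> ?C (\<lambda>s. - g s))" by (intro countable_Un countable_convex_corners)
  show "{t. (\<exists>l. (g has_real_derivative l) (at_left t)) \<and>
    (\<exists>r. (g has_real_derivative r) (at_right t)) \<and> \<not> (\<exists>d. (g has_real_derivative d) (at t))}
    \<subseteq> ?C g \<union> ?C (\<lambda>s. - g s)"
  proof
    fix t
    assume "t \<in> {t. (\<exists>l. (g has_real_derivative l) (at_left t)) \<and>
      (\<exists>r. (g has_real_derivative r) (at_right t)) \<and> \<not> (\<exists>d. (g has_real_derivative d) (at t))}"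
    then obtain l r where l: "(g has_real_derivative l) (at_left t)"
      and r: "(g has_real_derivative r) (at_right t)" and no: "\<nexists>d. (g has_real_derivative d) (at t)" by blast
    have "((\<lambda>s. - g s) has_real_derivative - l) (at_left t)" "((\<lambda>s. - g s) has_real_derivative - r) (at_right t)"
      using l r by (auto intro: derivative_intros)
    moreover have "l \<noteq> r" using has_real_derivative_of_one_sided l r no by blast
    then have "l < r \<or> - l < - r" by auto
    ultimately show "t \<in> ?C g \<union> ?C (\<lambda>s. - g s)" using l r by blast
  qed
qed

text \<open>The difference quotient of a convex function is monotone in the step and bounded below
  by the quotient of a unit step backwards, so it converges to its infimum.\<close>

lemma convex_has_dir_deriv:
  fixes f :: "'a::real_normed_vector \<Rightarrow> real"
  assumes conv: "convex_on UNIV f"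
  obtains d where "has_dir_deriv f x w d"
proof -
  define q where "q \<tau> = (f (x + \<tau> *\<^sub>R w) - f x) / \<tau>" for \<tau>
  have mono: "q \<sigma> \<le> q \<tau>" if "0 < \<sigma>" "\<sigma> \<le> \<tau>" for \<sigma> \<tau>
  proof -
    have eq: "x + \<sigma> *\<^sub>R w = (1 - \<sigma> / \<tau>) *\<^sub>R x + (\<sigma> / \<tau>) *\<^sub>R (x + \<tau> *\<^sub>R w)"
      using that by (simp add: algebra_simps)
    have "f (x + \<sigma> *\<^sub>R w) \<le> (1 - \<sigma> / \<tau>) * f x + (\<sigma> / \<tau>) * f (x + \<tau> *\<^sub>R w)"
      unfolding eq by (rule convex_onD[OF conv]) (use that in auto)
    then show ?thesis using that by (simp add: q_def field_simps)
  qed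
  have lower: "f x - f (x - w) \<le> q \<tau>" if "0 < \<tau>" for \<tau>
  proof -
    \<comment> \<open>The point x lies between x + \<tau> w and x - w; these are its barycentric
      weights.\<close>
    have eq: "(1 - \<tau> / (1 + \<tau>)) *\<^sub>R (x + \<tau> *\<^sub>R w) + (\<tau> / (1 + \<tau>)) *\<^sub>R (x - w) = x"
    proof -
      have "(1 - \<tau> / (1 + \<tau>)) *\<^sub>R (x + \<tau> *\<^sub>R w) + (\<tau> / (1 + \<tau>)) *\<^sub>R (x - w)
        = x + ((1 - \<tau> / (1 + \<tau>)) * \<tau> - \<tau> / (1 + \<tau>)) *\<^sub>R w" by (simp add: algebra_simps)
      also have "(1 - \<tau> / (1 + \<tau>)) * \<tau> - \<tau> / (1 + \<tau>) = 0" using that by (simp add: field_simps)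
      finally show ?thesis by simp
    qed
    have "f x \<le> (1 - \<tau> / (1 + \<tau>)) * f (x + \<tau> *\<^sub>R w) + (\<tau> / (1 + \<tau>)) * f (x - w)"
      using convex_onD[OF conv, of "\<tau> / (1 + \<tau>)" "x + \<tau> *\<^sub>R w" "x - w", unfolded eq] that by simp
    also have "1 - \<tau> / (1 + \<tau>) = 1 / (1 + \<tau>)" using that by (simp add: field_simps)
    also have "1 / (1 + \<tau>) * f (x + \<tau> *\<^sub>R w) + (\<tau> / (1 + \<tau>)) * f (x - w)
      = (f (x + \<tau> *\<^sub>R w) + \<tau> * f (x - w)) / (1 + \<tau>)" by (simp add: add_divide_distrib)
    finally have "(1 + \<tau>) * f x \<le> f (x + \<tau> *\<^sub>R w) + \<tau> * f (x - w)"
      using that by (simp add: pos_le_divide_eq mult.commute)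
    then show ?thesis using that by (simp add: q_def field_simps)
  qed
  have bdd: "bdd_below (q ` {0<..})" by (intro bdd_belowI2[where m = "f x - f (x - w)"]) (simp add: lower)
  have "(q \<longlongrightarrow> (INF \<tau>\<in>{0<..}. q \<tau>)) (at_right 0)"
  proof (rule order_tendstoI)
    fix a assume "a < (INF \<tau>\<in>{0<..}. q \<tau>)"
    then have "a < q \<tau>" if "\<tau> > 0" for \<tau> using cINF_lower[OF bdd, of \<tau>] that by simp
    then show "\<forall>\<^sub>F \<tau> in at_right 0. a < q \<tau>" by (simp add: eventually_at_right_less eventually_mono[OF eventually_at_right_less])
  next
    fix a assume "(INF \<tau>\<in>{0<..}. q \<tau>) < a"
    then obtain \<tau>0 where "\<tau>0 > 0" "q \<tau>0 < a" by (subst (asm) cINF_less_iff[OF _ bdd]) auto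
    then show "\<forall>\<^sub>F \<tau> in at_right 0. q \<tau> < a"
      unfolding eventually_at_right_field by (intro exI[of _ \<tau>0]) (metis mono less_imp_le le_less_trans)
  qed
  then show ?thesis using that unfolding has_dir_deriv_def q_def by blast
qed

text \<open>The curve departs from its tangent by o(s - t), and the Lipschitz bound passes this
  error on to \<open>f\<close>; along the tangent itself the derivative is the directional
  one.\<close>

lemma dir_deriv_along_curve:
  fixes f :: "'a::real_normed_vector \<Rightarrow> real" and x :: "real \<Rightarrow> 'a"
  assumes lip: "L-lipschitz_on (ball (x t) e) f" and "e > 0"
    and d: "has_dir_deriv f (x t) w d"
    and x: "(x has_vector_derivative w) (at_right t)"
  shows "((\<lambda>s. f (x s)) has_real_derivative d) (at_right t)"
proof -
  let ?p = "\<lambda>s. x t + (s - t) *\<^sub>R w"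
  have "((\<lambda>s. norm ((1 / norm (s - t)) *\<^sub>R (x s - (x t + (s - t) *\<^sub>R w)))) \<longlongrightarrow> 0) (at_right t)"
    using x unfolding has_vector_derivative_def has_derivative_within by (intro tendsto_norm_zero) simp
  then have lim0: "((\<lambda>s. L * norm ((1 / norm (s - t)) *\<^sub>R (x s - ?p s))) \<longlongrightarrow> 0) (at_right t)"
    by (rule tendsto_mult_right_zero)
  have "(x \<longlongrightarrow> x t) (at_right t)"
    using has_vector_derivative_continuous[OF x] by (simp add: continuous_within)
  then have ev1: "\<forall>\<^sub>F s in at_right t. x s \<in> ball (x t) e"
    unfolding mem_ball by (subst dist_commute) (rule tendstoD[OF _ \<open>e > 0\<close>])
  have "(?p \<longlongrightarrow> x t + (t - t) *\<^sub>R w) (at_right t)" by (intro tendsto_intros)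
  then have ev2: "\<forall>\<^sub>F s in at_right t. ?p s \<in> ball (x t) e"
    using tendstoD[OF _ \<open>e > 0\<close>, of ?p "x t" "at_right t"] by (simp add: dist_commute)
  have "\<forall>\<^sub>F s in at_right t. norm ((f (x s) - f (?p s)) / (s - t)) \<le> L * norm ((1 / norm (s - t)) *\<^sub>R (x s - ?p s))"
    using ev1 ev2 eventually_at_right_less[of t]
  proof eventually_elim
    case (elim s)
    then have "norm (f (x s) - f (?p s)) \<le> L * norm (x s - ?p s)"
      using lipschitz_on_normD[OF lip] by blast
    then show ?case using elim(3) by (simp add: divide_right_mono)
  qed
  then have l1: "((\<lambda>s. (f (x s) - f (?p s)) / (s - t)) \<longlongrightarrow> 0) (at_right t)"
    by (rule Lim_null_comparison) (rule lim0)
  have l2: "((\<lambda>s. (f (?p s) - f (x t)) / (s - t)) \<longlongrightarrow> d) (at_right t)"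
    using d unfolding has_dir_deriv_def at_right_to_0[of t] filterlim_filtermap by simp
  have "((\<lambda>s. (f (x s) - f (x t)) / (s - t)) \<longlongrightarrow> 0 + d) (at_right t)"
    by (rule Lim_transform_eventually[OF tendsto_add[OF l1 l2]]) (simp flip: add_divide_distrib)
  then show ?thesis by (simp add: has_field_derivative_iff)
qed

lemma has_vector_derivative_minus_id: "(uminus has_vector_derivative - 1) (at (a :: real) within S)"
  using has_vector_derivative_minus[OF has_vector_derivative_id] by simp

text \<open>Time reversal turns the left derivative along \<open>w\<close> into a right derivative
  along \<open>- w\<close>, hence the two signs.\<close>

lemma dir_deriv_along_curve_left:
  fixes f :: "'a::real_normed_vector \<Rightarrow> real" and x :: "real \<Rightarrow> 'a"
  assumes lip: "L-lipschitz_on (ball (x t) e) f" and "e > 0"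
    and d: "has_dir_deriv f (x t) (- w) d"
    and x: "(x has_vector_derivative w) (at_left t)"
  shows "((\<lambda>s. f (x s)) has_real_derivative - d) (at_left t)"
proof -
  have "((\<lambda>s. x (- s)) has_vector_derivative - w) (at_right (- t))"
    using vector_diff_chain_within[of uminus "- 1" "- t" "{- t<..}" x w] x
    by (simp add: o_def has_vector_derivative_minus_id)
  then have "((\<lambda>s. f (x (- s))) has_real_derivative d) (at_right (- t))"
    using lip d by (intro dir_deriv_along_curve[OF _ \<open>e > 0\<close>]) auto
  then have "((\<lambda>s. (f (x (- s)) - f (x t)) / (s + t)) \<longlongrightarrow> d) (at_right (- t))"
    by (simp add: has_field_derivative_iff)
  then have "((\<lambda>s. (f (x s) - f (x t)) / (- s + t)) \<longlongrightarrow> d) (at_left t)"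
    by (subst filterlim_at_left_to_right) simp
  then have "((\<lambda>s. - ((f (x s) - f (x t)) / (- s + t))) \<longlongrightarrow> - d) (at_left t)"
    by (rule tendsto_minus)
  moreover have "- (a / (- s + t)) = a / (s - t)" for a s
    by (metis add.commute minus_diff_eq minus_divide_right uminus_add_conv_diff)
  ultimately show ?thesis by (simp add: has_field_derivative_iff)
qed

section \<open>Global solutions of dissipative equations\<close>

lemma integral_has_vector_derivative_atLeast:
  fixes g :: "real \<Rightarrow> 'a::banach"
  assumes "continuous_on {a..} g" "a \<le> t"
  shows "((\<lambda>p. integral {a..p} g) has_vector_derivative g t) (at t within {a..})"
proof -
  have "((\<lambda>p. integral {a..p} g) has_vector_derivative g t) (at t within {a..t + 1})"
    using assms by (intro integral_has_vector_derivative continuous_on_subset[OF assms(1)]) auto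
  moreover have "at t within {a..t + 1} = at t within {a..}"
    by (rule at_within_nhd[of t "{..<t + 1}"]) (use assms in auto)
  ultimately show ?thesis by simp
qed

lemma exp_has_integral:
  fixes c :: real
  assumes "0 < c" "0 \<le> p"
  shows "((\<lambda>s. exp (c * s)) has_integral (exp (c * p) - 1) / c) {0..p}"
proof -
  have "((\<lambda>s. exp (c * s)) has_integral exp (c * p) / c - exp (c * 0) / c) {0..p}"
    using assms by (intro fundamental_theorem_of_calculus)
      (auto intro!: derivative_eq_intros simp flip: has_real_derivative_iff_has_vector_derivative)
  then show ?thesis by (simp add: diff_divide_distrib)
qed

text \<open>Picard iteration is a contraction on all of \<open>[0,\<infinity>)\<close> in the weighted norm
  \<open>sup exp (- c * t) * norm (x t)\<close> with \<open>c > L\<close>; negative times are clamped to \<open>0\<close>.\<close>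

lemma global_solution_exists_lipschitz:
  fixes v :: "'a::euclidean_space \<Rightarrow> 'a"
  assumes lip: "L-lipschitz_on UNIV v" and bnd: "\<And>z. norm (v z) \<le> B"
  obtains x where "global_solution v x0 x"
proof -
  have "L \<ge> 0" using lip by (rule lipschitz_on_nonneg)
  have "B \<ge> 0" using bnd[of 0] norm_ge_zero order_trans by blast
  \<comment> \<open>Any rate above \<open>L\<close> makes \<open>L / c\<close> a contraction
    factor.\<close>
  define c where "c = L + 1"
  have c: "c > 0" "c > L" using \<open>L \<ge> 0\<close> by (auto simp: c_def)
  have exp_ge_self: "q \<le> exp q" for q :: real using exp_ge_add_one_self[of q] by linarith
  have contv: "continuous_on UNIV v" by (rule lipschitz_on_continuous_on[OF lip])
  \<comment> \<open>The unknown is y t = exp (- c t) x t, so the plain sup norm of bounded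
    continuous functions on y is the weighted norm on x.\<close>
  define g where "g y s = v (exp (c * s) *\<^sub>R apply_bcontfun y s)" for y and s :: real
  have contg: "continuous_on S (g y)" for S y
    unfolding g_def by (intro continuous_on_compose2[OF contv] continuous_intros) auto
  have intg: "g y integrable_on {0..p}" for y p
    by (intro integrable_continuous_interval contg)
  define T where "T y t = exp (- c * max 0 t) *\<^sub>R (x0 + integral {0..max 0 t} (g y))" for y t
  have "T y \<in> bcontfun" for y
  proof -
    have "continuous_on {0..} (\<lambda>p. integral {0..p} (g y))"
      unfolding continuous_on_eq_continuous_within
      using integral_has_vector_derivative_atLeast[OF contg] has_vector_derivative_continuous by fastforce
    then have "continuous_on UNIV (\<lambda>t. integral {0..max 0 t} (g y))"
      by (rule continuous_on_compose2) (auto intro!: continuous_intros)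
    then have "continuous_on UNIV (T y)"
      unfolding T_def by (intro continuous_intros)
    moreover have "norm (T y t) \<le> norm x0 + B / c" for t
    proof -
      define p where "p = max 0 t"
      have "p \<ge> 0" by (simp add: p_def)
      have "norm (integral {0..p} (g y)) \<le> B * p"
        using integral_bound[of 0 p "g y" B] \<open>p \<ge> 0\<close> contg bnd by (simp add: g_def)
      then have "norm (x0 + integral {0..p} (g y)) \<le> norm x0 + B * p"
        by (intro norm_triangle_le) simp
      then have "norm (T y t) \<le> exp (- c * p) * (norm x0 + B * p)"
        by (simp add: T_def p_def)
      \<comment> \<open>Isolates the factor q exp (- q) with q = c p, which is at most 1.\<close>
      also have "\<dots> = exp (- c * p) * norm x0 + (B / c) * (c * p * exp (- c * p))"
        using c by (simp add: algebra_simps)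
      also have "c * p * exp (- c * p) \<le> 1"
        using exp_ge_self[of "c * p"]
        by (simp add: exp_minus pos_divide_le_eq divide_inverse[symmetric])
      then have "(B / c) * (c * p * exp (- c * p)) \<le> (B / c) * 1"
        using \<open>B \<ge> 0\<close> c by (intro mult_left_mono) auto
      also have "exp (- c * p) * norm x0 \<le> 1 * norm x0"
        using c \<open>p \<ge> 0\<close> by (intro mult_right_mono) auto
      finally show ?thesis by simp
    qed
    then have "bounded (range (T y))" by (auto intro: boundedI)
    ultimately show ?thesis by (simp add: bcontfun_def)
  qed
  then have T: "apply_bcontfun (Bcontfun (T y)) = T y" for y by (simp add: Bcontfun_inverse)
  have contr: "dist (Bcontfun (T y)) (Bcontfun (T z)) \<le> (L / c) * dist y z" for y z
  proof (rule dist_bound)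
    fix t :: real
    define p where "p = max 0 t"
    have "p \<ge> 0" by (simp add: p_def)
    have int: "((\<lambda>s. L * dist y z * exp (c * s)) has_integral L * dist y z * ((exp (c * p) - 1) / c)) {0..p}"
      by (intro has_integral_mult_right exp_has_integral c \<open>p \<ge> 0\<close>)
    have "norm (integral {0..p} (\<lambda>s. g y s - g z s)) \<le> integral {0..p} (\<lambda>s. L * dist y z * exp (c * s))"
    proof (rule integral_norm_bound_integral)
      show "(\<lambda>s. g y s - g z s) integrable_on {0..p}" by (intro integrable_diff intg)
      show "(\<lambda>s. L * dist y z * exp (c * s)) integrable_on {0..p}" using int by blast
      fix s assume "s \<in> {0..p}"
      have "norm (g y s - g z s) \<le> L * norm (exp (c * s) *\<^sub>R y s - exp (c * s) *\<^sub>R z s)"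
        unfolding g_def by (rule lipschitz_on_normD[OF lip]) auto
      also have "\<dots> = L * exp (c * s) * dist (y s) (z s)"
        by (simp add: dist_norm flip: scaleR_diff_right)
      also have "\<dots> \<le> L * exp (c * s) * dist y z"
        using \<open>L \<ge> 0\<close> by (intro mult_left_mono dist_bounded) auto
      finally show "norm (g y s - g z s) \<le> L * dist y z * exp (c * s)" by (simp add: mult_ac)
    qed
    also have "\<dots> = L * dist y z * ((exp (c * p) - 1) / c)" using int by (rule integral_unique)
    finally have le: "norm (integral {0..p} (g y) - integral {0..p} (g z)) \<le> L * dist y z * ((exp (c * p) - 1) / c)"
      by (simp add: integral_diff intg)
    have "dist (T y t) (T z t) = exp (- c * p) * norm (integral {0..p} (g y) - integral {0..p} (g z))"
      by (simp add: T_def p_def dist_norm flip: scaleR_diff_right)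
    also have "\<dots> \<le> exp (- c * p) * (L * dist y z * ((exp (c * p) - 1) / c))"
      by (intro mult_left_mono le) simp
    also have "\<dots> = (L / c) * dist y z * (1 - exp (- c * p))"
      by (simp add: exp_minus field_simps)
    also have "\<dots> \<le> (L / c) * dist y z * 1"
      using \<open>L \<ge> 0\<close> c by (intro mult_left_mono) auto
    finally show "dist (Bcontfun (T y) t) (Bcontfun (T z) t) \<le> (L / c) * dist y z" by (simp add: T)
  qed
  obtain y where y: "Bcontfun (T y) = y"
    using banach_fix_type[of "L / c" "\<lambda>y. Bcontfun (T y)"] contr c \<open>L \<ge> 0\<close> by auto
  define x where "x t = exp (c * t) *\<^sub>R apply_bcontfun y t" for t
  have x: "x t = x0 + integral {0..t} (g y)" if "t \<ge> 0" for t
  proof -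
    have "apply_bcontfun y t = T y t" using y T by metis
    then show ?thesis using that by (simp add: x_def T_def exp_minus)
  qed
  have "global_solution v x0 x"
    unfolding global_solution_def
  proof (intro conjI allI impI)
    show "x 0 = x0" by (simp add: x)
    fix t :: real assume "t \<ge> 0"
    have "((\<lambda>p. x0 + integral {0..p} (g y)) has_vector_derivative v (x t)) (at t within {0..})"
      using integral_has_vector_derivative_atLeast[OF contg \<open>t \<ge> 0\<close>, of y]
      by (auto intro!: derivative_eq_intros simp: g_def x_def)
    then show "(x has_vector_derivative v (x t)) (at t within {0..})"
      by (rule has_vector_derivative_transform[rotated 2]) (use \<open>t \<ge> 0\<close> in \<open>auto simp: x\<close>)
  qed
  then show thesis by (rule that)
qed

lemma global_solution_continuous:
  assumes "global_solution v x0 x"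
  shows "continuous_on {0..} x"
  unfolding continuous_on_eq_continuous_within
proof
  fix t :: real assume "t \<in> {0..}"
  then show "continuous (at t within {0..}) x"
    using assms by (intro has_vector_derivative_continuous[of x "v (x t)"]) (simp add: global_solution_def)
qed

lemma global_solution_within:
  assumes "global_solution v x0 x" "t \<ge> 0" "S \<subseteq> {0..}"
  shows "(x has_vector_derivative v (x t)) (at t within S)"
proof -
  have "(x has_vector_derivative v (x t)) (at t within {0..})"
    using assms(1,2) by (simp add: global_solution_def)
  then show ?thesis using assms(3) by (rule has_vector_derivative_within_subset)
qed

lemma global_solution_right:
  assumes "global_solution v x0 x" "t \<ge> 0"
  shows "(x has_vector_derivative v (x t)) (at_right t)"
  by (rule global_solution_within[OF assms]) (use assms(2) in \<open>simp add: subset_iff\<close>)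

lemma global_solution_at:
  assumes "global_solution v x0 x" "t > 0"
  shows "(x has_vector_derivative v (x t)) (at t)"
proof -
  have "(x has_vector_derivative v (x t)) (at t within {0<..})"
    by (rule global_solution_within[OF assms(1)]) (use assms(2) in auto)
  moreover have "at t within {0<..} = at t" using assms(2) by (intro at_within_open) auto
  ultimately show ?thesis by simp
qed

lemma has_real_derivative_inner:
  assumes "(x has_vector_derivative a) (at t within S)" "(y has_vector_derivative b) (at t within S)"
  shows "((\<lambda>r. x r \<bullet> y r) has_real_derivative x t \<bullet> b + a \<bullet> y t) (at t within S)"
  using has_derivative_inner[OF assms[unfolded has_vector_derivative_def]]
  unfolding has_field_derivative_def
  by (rule has_derivative_eq_rhs) (auto simp: algebra_simps)

text \<open>The squared norm has right derivative 2 <x, v x> \<le> 0. This a priori bound confines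
  solutions to a ball.\<close>

lemma global_solution_norm_le:
  fixes x :: "real \<Rightarrow> 'a::real_inner"
  assumes sol: "global_solution v x0 x" and dec: "\<And>z. z \<bullet> v z \<le> 0" and "s \<ge> 0" "s \<le> t"
  shows "norm (x t) \<le> norm (x s)"
proof -
  have "x t \<bullet> x t \<le> x s \<bullet> x s"
  proof (rule right_derivative_nonpos_imp_le[OF \<open>s \<le> t\<close>])
    show "continuous_on {s..t} (\<lambda>r. x r \<bullet> x r)"
      using global_solution_continuous[OF sol] \<open>s \<ge> 0\<close>
      by (intro continuous_intros) (auto intro: continuous_on_subset)
    fix r assume "s \<le> r" "r < t"
    then have "(x has_vector_derivative v (x r)) (at_right r)"
      using global_solution_right[OF sol] \<open>s \<ge> 0\<close> by auto
    then have "((\<lambda>r. x r \<bullet> x r) has_real_derivative x r \<bullet> v (x r) + v (x r) \<bullet> x r) (at_right r)"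
      by (intro has_real_derivative_inner)
    then show "\<exists>d\<le>0. ((\<lambda>r. x r \<bullet> x r) has_real_derivative d) (at_right r)"
      using dec[of "x r"] by (intro exI[of _ "2 * (x r \<bullet> v (x r))"]) (simp add: inner_commute)
  qed
  then show ?thesis by (simp add: norm_le)
qed

text \<open>Gronwall in differential form: the exponential factor absorbs the Lipschitz growth of |y
  - x|^2, which starts at 0.\<close>

lemma global_solution_unique:
  fixes x y :: "real \<Rightarrow> 'a::real_inner"
  assumes x: "global_solution v x0 x" and y: "global_solution v x0 y"
    and lip: "L-lipschitz_on S v" and S: "\<And>t. t \<ge> 0 \<Longrightarrow> x t \<in> S" "\<And>t. t \<ge> 0 \<Longrightarrow> y t \<in> S"
    and "t \<ge> 0"
  shows "y t = x t"
proof -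
  let ?e = "\<lambda>r. exp (- 2 * L * r) * ((y r - x r) \<bullet> (y r - x r))"
  have "?e t \<le> ?e 0"
  proof (rule right_derivative_nonpos_imp_le[OF \<open>t \<ge> 0\<close>])
    show "continuous_on {0..t} ?e"
      using global_solution_continuous[OF x] global_solution_continuous[OF y]
      by (intro continuous_intros) (auto intro: continuous_on_subset)
    fix r :: real assume "0 \<le> r" "r < t"
    have "((\<lambda>r. y r - x r) has_vector_derivative v (y r) - v (x r)) (at_right r)"
      by (intro has_vector_derivative_diff global_solution_right[OF x] global_solution_right[OF y] \<open>0 \<le> r\<close>)
    then have "((\<lambda>r. (y r - x r) \<bullet> (y r - x r)) has_real_derivative
        (y r - x r) \<bullet> (v (y r) - v (x r)) + (v (y r) - v (x r)) \<bullet> (y r - x r)) (at_right r)"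
      by (intro has_real_derivative_inner)
    moreover have "((\<lambda>r. exp (- 2 * L * r)) has_real_derivative exp (- 2 * L * r) * (- 2 * L)) (at_right r)"
      by (auto intro!: derivative_eq_intros)
    ultimately have d: "(?e has_real_derivative exp (- 2 * L * r) *
        (2 * ((y r - x r) \<bullet> (v (y r) - v (x r))) - 2 * L * ((y r - x r) \<bullet> (y r - x r)))) (at_right r)"
      by (intro DERIV_cong[OF DERIV_mult]) (auto simp: inner_commute algebra_simps)
    have "(y r - x r) \<bullet> (v (y r) - v (x r)) \<le> norm (y r - x r) * norm (v (y r) - v (x r))"
      by (rule norm_cauchy_schwarz)
    also have "\<dots> \<le> norm (y r - x r) * (L * norm (y r - x r))"
      using S \<open>0 \<le> r\<close> by (intro mult_left_mono lipschitz_on_normD[OF lip]) auto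
    also have "\<dots> = L * ((y r - x r) \<bullet> (y r - x r))"
      by (simp add: power2_eq_square flip: power2_norm_eq_inner)
    finally have "exp (- 2 * L * r) *
        (2 * ((y r - x r) \<bullet> (v (y r) - v (x r))) - 2 * L * ((y r - x r) \<bullet> (y r - x r))) \<le> 0"
      by (intro mult_nonneg_nonpos) auto
    with d show "\<exists>d\<le>0. (?e has_real_derivative d) (at_right r)" by blast
  qed
  then have "(y t - x t) \<bullet> (y t - x t) \<le> 0"
    using x y by (simp add: global_solution_def mult_le_0_iff)
  then show ?thesis by (metis inner_ge_zero inner_eq_zero_iff order_antisym right_minus_eq)
qed

text \<open>Serves the truncation of a homogeneous field: since the projection only rescales by a
  nonnegative factor, the sign of \<open>z \<bullet> v z\<close> survives.\<close>

lemma closest_point_cball_0: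
  fixes a :: "'a::euclidean_space"
  assumes "R \<ge> 0"
  obtains s where "0 \<le> s" "closest_point (cball 0 R) a = s *\<^sub>R a"
proof (cases "norm a \<le> R")
  case True
  then show ?thesis using that[of 1] by (simp add: closest_point_self)
next
  case False
  then have "norm a > 0" using assms by linarith
  have "(R / norm a) *\<^sub>R a = closest_point (cball 0 R) a"
  proof (rule closest_point_unique)
    show "(R / norm a) *\<^sub>R a \<in> cball 0 R" using \<open>norm a > 0\<close> assms by simp
    have "a - (R / norm a) *\<^sub>R a = (1 - R / norm a) *\<^sub>R a" by (simp add: algebra_simps)
    then have "dist a ((R / norm a) *\<^sub>R a) = \<bar>1 - R / norm a\<bar> * norm a" by (simp add: dist_norm)
    also have "\<dots> = norm a - R" using False \<open>norm a > 0\<close> by (simp add: abs_if field_simps)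
    finally have dist_eq: "dist a ((R / norm a) *\<^sub>R a) = norm a - R" .
    show "\<forall>z\<in>cball 0 R. dist a ((R / norm a) *\<^sub>R a) \<le> dist a z"
    proof
      fix z :: 'a assume "z \<in> cball 0 R"
      then show "dist a ((R / norm a) *\<^sub>R a) \<le> dist a z"
        using norm_triangle_sub[of a z] dist_eq by (simp add: dist_norm)
    qed
  qed auto
  then show ?thesis using that[of "R / norm a"] assms by simp
qed

text \<open>Composing \<open>v\<close> with the projection onto the ball of radius \<open>norm x0\<close> makes it globally
  Lipschitz and bounded; by homogeneity and dissipativity the solution never leaves the ball.\<close>

lemma global_solution_exists_dissipative:
  fixes v :: "'a::euclidean_space \<Rightarrow> 'a"
  assumes lip: "\<And>R. \<exists>L. L-lipschitz_on (cball 0 R) v"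
    and hom: "\<And>s z. v (s *\<^sub>R z) = s ^ k *\<^sub>R v z" and dec: "\<And>z. z \<bullet> v z \<le> 0"
  obtains x where "global_solution v x0 x"
proof -
  define R where "R = norm x0"
  have "R \<ge> 0" by (simp add: R_def)
  let ?P = "closest_point (cball (0::'a) R)"
  have P: "?P z \<in> cball 0 R" for z
    using \<open>R \<ge> 0\<close> by (intro closest_point_in_set) auto
  have "1-lipschitz_on UNIV ?P"
    using \<open>R \<ge> 0\<close> by (intro lipschitz_onI) (auto intro!: closest_point_lipschitz)
  obtain L where L: "L-lipschitz_on (cball 0 R) v" using lip by blast
  then have "L-lipschitz_on (?P ` UNIV) v" using P by (blast intro: lipschitz_on_subset)
  then have "(L * 1)-lipschitz_on UNIV (\<lambda>z. v (?P z))"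
    by (rule lipschitz_on_compose2[OF \<open>1-lipschitz_on UNIV ?P\<close>])
  moreover have "compact (v ` cball 0 R)"
    by (intro compact_continuous_image lipschitz_on_continuous_on[OF L] compact_cball)
  then have "bounded (v ` cball 0 R)" by (rule compact_imp_bounded)
  then obtain B where B: "\<forall>z\<in>cball 0 R. norm (v z) \<le> B"
    unfolding bounded_iff by (meson imageI)
  then have "norm (v (?P z)) \<le> B" for z using B P[of z] by blast
  ultimately obtain x where x: "global_solution (\<lambda>z. v (?P z)) x0 x"
    by (rule global_solution_exists_lipschitz)
  have decP: "z \<bullet> v (?P z) \<le> 0" for z
  proof -
    obtain s where "0 \<le> s" "?P z = s *\<^sub>R z" using closest_point_cball_0[OF \<open>R \<ge> 0\<close>] by blast
    then show ?thesis using dec[of z] by (simp add: hom mult_nonneg_nonpos)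
  qed
  have "x t \<in> cball 0 R" if "t \<ge> 0" for t
    using global_solution_norm_le[OF x decP order_refl that] x by (simp add: global_solution_def R_def)
  then have "global_solution v x0 x"
    using x unfolding global_solution_def by (simp add: closest_point_self)
  then show thesis by (rule that)
qed

section \<open>The gradient of c and the Hessian of f\<close>

lemma grad_eqI: "GDERIV f z :> g \<Longrightarrow> grad f z = g"
  unfolding grad_def
proof (rule the_equality)
  fix g' assume "GDERIV f z :> g" "GDERIV f z :> g'"
  then have "(\<lambda>h. h \<bullet> g) = (\<lambda>h. h \<bullet> g')" unfolding gderiv_def by (rule has_derivative_unique)
  then show "g' = g" by (metis vector_eq_ldot)
qed

definition imbalance :: "(real^'r^'m) \<times> (real^'n^'r) \<Rightarrow> real^'r^'r" where
  "imbalance z = transpose (fst z) ** fst z - snd z ** transpose (snd z)"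

definition c_grad :: "(real^'r^'m) \<times> (real^'n^'r) \<Rightarrow> (real^'r^'m) \<times> (real^'n^'r)" where
  "c_grad z = (fst z ** imbalance z, - (imbalance z ** snd z))"

lemma transpose_imbalance [simp]: "transpose (imbalance z) = imbalance z"
  by (simp add: imbalance_def transpose_diff matrix_transpose_mul)

lemma mf_c_imbalance: "mf_c z = (imbalance z \<bullet> imbalance z) / 4"
  by (simp add: mf_c_def imbalance_def case_prod_unfold power2_norm_eq_inner)

lemma mf_c_nonneg: "mf_c z \<ge> 0"
  by (simp add: mf_c_imbalance)

lemma mf_c_eq_0_iff: "mf_c z = 0 \<longleftrightarrow> imbalance z = 0"
  by (simp add: mf_c_imbalance)

lemma balanced_iff_imbalance: "balanced z \<longleftrightarrow> imbalance z = 0"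
  by (simp add: balanced_def imbalance_def case_prod_unfold)

lemmas has_derivative_matrix_mul [derivative_intros] = bounded_bilinear.FDERIV[OF bounded_bilinear_matrix_mul]
lemmas has_derivative_transpose [derivative_intros] = bounded_linear.has_derivative[OF bounded_linear_transpose]

lemma inner_symmetric_transpose_mul:
  fixes D :: "real^'r^'r" and X H :: "real^'r^'m"
  assumes "transpose D = D"
  shows "D \<bullet> (transpose X ** H) = (X ** D) \<bullet> H" "D \<bullet> (transpose H ** X) = (X ** D) \<bullet> H"
proof -
  show 1: "D \<bullet> (transpose X ** H) = (X ** D) \<bullet> H" by (simp add: inner_matrix_mul_left)
  have "D \<bullet> (transpose H ** X) = transpose D \<bullet> transpose (transpose H ** X)" by (simp only: inner_transpose)
  then show "D \<bullet> (transpose H ** X) = (X ** D) \<bullet> H"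
    using 1 assms by (simp add: matrix_transpose_mul)
qed

lemma inner_symmetric_mul_transpose:
  fixes D :: "real^'r^'r" and Y K :: "real^'n^'r"
  assumes "transpose D = D"
  shows "D \<bullet> (K ** transpose Y) = (D ** Y) \<bullet> K" "D \<bullet> (Y ** transpose K) = (D ** Y) \<bullet> K"
proof -
  show 1: "D \<bullet> (K ** transpose Y) = (D ** Y) \<bullet> K" by (simp add: inner_matrix_mul_right)
  have "D \<bullet> (Y ** transpose K) = transpose D \<bullet> transpose (Y ** transpose K)" by (simp only: inner_transpose)
  then show "D \<bullet> (Y ** transpose K) = (D ** Y) \<bullet> K"
    using 1 assms by (simp add: matrix_transpose_mul)
qed

text \<open>The factor 1/4 in \<open>mf_c\<close> cancels against one 2 from the square and one 2
  from the symmetry of \<open>imbalance z\<close>.\<close>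

lemma gderiv_mf_c: "GDERIV mf_c z :> c_grad z"
proof -
  let ?X = "fst z" and ?Y = "snd z" and ?D = "imbalance z"
  let ?D' = "\<lambda>h. transpose ?X ** fst h + transpose (fst h) ** ?X
        - (?Y ** transpose (snd h) + snd h ** transpose ?Y)"
  have D: "(imbalance has_derivative ?D') (at z)"
    unfolding imbalance_def by (auto intro!: derivative_eq_intros)
  have "((\<lambda>z. (imbalance z \<bullet> imbalance z) / 4) has_derivative (\<lambda>h. (?D \<bullet> ?D' h + ?D' h \<bullet> ?D) / 4)) (at z)"
    by (auto intro!: derivative_eq_intros D)
  moreover have "(?D \<bullet> ?D' h + ?D' h \<bullet> ?D) / 4 = h \<bullet> c_grad z" for h
  proof -
    have "?D \<bullet> ?D' h = 2 * ((?X ** ?D) \<bullet> fst h) - 2 * ((?D ** ?Y) \<bullet> snd h)"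
      using inner_symmetric_transpose_mul(1)[OF transpose_imbalance, of z ?X "fst h"]
        inner_symmetric_transpose_mul(2)[OF transpose_imbalance, of z "fst h" ?X]
        inner_symmetric_mul_transpose(1)[OF transpose_imbalance, of z "snd h" ?Y]
        inner_symmetric_mul_transpose(2)[OF transpose_imbalance, of z ?Y "snd h"]
      by (simp add: inner_diff_right inner_add_right)
    then show ?thesis
      by (simp add: inner_commute[of "?D' h"] c_grad_def inner_prod_def inner_commute[of "fst h"]
          inner_commute[of "snd h"])
  qed
  ultimately show ?thesis
    unfolding gderiv_def mf_c_imbalance[abs_def] by simp
qed

lemma grad_mf_c: "grad mf_c = c_grad"
  using grad_eqI[OF gderiv_mf_c] by blast

text \<open>Euler's identity for a quartic: both sides are \<open>4 * mf_c z\<close>. It yields the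
  dissipativity of the flow and the characterisation of critical points.\<close>

lemma inner_c_grad: "z \<bullet> c_grad z = imbalance z \<bullet> imbalance z"
proof -
  let ?X = "fst z" and ?Y = "snd z" and ?D = "imbalance z"
  have "z \<bullet> c_grad z = ?X \<bullet> (?X ** ?D) - ?Y \<bullet> (?D ** ?Y)"
    by (cases z) (simp add: c_grad_def)
  also have "\<dots> = ?D \<bullet> (transpose ?X ** ?X) - ?D \<bullet> (?Y ** transpose ?Y)"
    by (simp add: inner_symmetric_transpose_mul inner_symmetric_mul_transpose inner_commute)
  also have "\<dots> = ?D \<bullet> ?D" by (simp add: imbalance_def flip: inner_diff_right)
  finally show ?thesis .
qed

lemma c_grad_eq_0_iff: "c_grad z = 0 \<longleftrightarrow> imbalance z = 0"
proof
  assume "c_grad z = 0"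
  then show "imbalance z = 0" using inner_c_grad[of z] by simp
qed (simp add: c_grad_def zero_prod_def)

lemma c_grad_scaleR: "c_grad (s *\<^sub>R z) = s ^ 3 *\<^sub>R c_grad z"
proof -
  have "imbalance (s *\<^sub>R z) = s\<^sup>2 *\<^sub>R imbalance z"
    by (simp add: imbalance_def transpose_scalar mul.scaleR_left mul.scaleR_right
        scaleR_diff_right power2_eq_square)
  then show ?thesis
    by (simp add: c_grad_def mul.scaleR_left mul.scaleR_right power2_eq_square power3_eq_cube mult_ac)
qed

lemma lipschitz_on_matrix_mul:
  fixes f :: "'a::euclidean_space \<Rightarrow> real^'b^'c" and g :: "'a \<Rightarrow> real^'d^'b"
  assumes "bounded S" "\<exists>L. L-lipschitz_on S f" "\<exists>L. L-lipschitz_on S g"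
  shows "\<exists>L. L-lipschitz_on S (\<lambda>z. f z ** g z)"
proof -
  obtain L1 L2 where L: "L1-lipschitz_on S f" "L2-lipschitz_on S g" using assms by blast
  then have "bounded (f ` S)" "bounded (g ` S)"
    using assms(1) by (auto intro!: bounded_uniformly_continuous_image lipschitz_on_uniformly_continuous)
  then obtain B1 B2 where B1: "\<And>z. z \<in> S \<Longrightarrow> norm (f z) \<le> B1" and B2: "\<And>z. z \<in> S \<Longrightarrow> norm (g z) \<le> B2"
    unfolding bounded_iff by (metis imageI)
  have "(\<bar>B1\<bar> * L2 + L1 * \<bar>B2\<bar>)-lipschitz_on S (\<lambda>z. f z ** g z)"
  proof (rule lipschitz_onI)
    fix x y assume S: "x \<in> S" "y \<in> S"
    have "f x ** g x - f y ** g y = f x ** (g x - g y) + (f x - f y) ** g y"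
      by (simp add: mul.diff_left mul.diff_right)
    then have "dist (f x ** g x) (f y ** g y) \<le> norm (f x ** (g x - g y)) + norm ((f x - f y) ** g y)"
      by (simp add: dist_norm norm_triangle_ineq)
    also have "\<dots> \<le> norm (f x) * norm (g x - g y) + norm (f x - f y) * norm (g y)"
      by (intro add_mono norm_matrix_mul)
    also have "\<dots> \<le> \<bar>B1\<bar> * (L2 * dist x y) + (L1 * dist x y) * \<bar>B2\<bar>"
    proof -
      have "norm (f x) \<le> \<bar>B1\<bar>" using B1[OF S(1)] by linarith
      moreover have "norm (g y) \<le> \<bar>B2\<bar>" using B2[OF S(2)] by linarith
      ultimately show ?thesis
      using lipschitz_onD[OF L(1) S] lipschitz_onD[OF L(2) S] lipschitz_on_nonneg[OF L(1)]
      by (intro add_mono mult_mono) (auto simp: dist_norm)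
    qed
    finally show "dist (f x ** g x) (f y ** g y) \<le> (\<bar>B1\<bar> * L2 + L1 * \<bar>B2\<bar>) * dist x y"
      by (simp add: algebra_simps)
  qed (use lipschitz_on_nonneg[OF L(1)] lipschitz_on_nonneg[OF L(2)] in auto)
  then show ?thesis ..
qed

lemma lipschitz_on_bounded_linear: "bounded_linear f \<Longrightarrow> \<exists>L. L-lipschitz_on S f"
  by (rule bounded_linear.lipschitz_boundE) blast+

lemma lipschitz_on_c_grad: 
  fixes S :: "((real^'r^'m) \<times> (real^'n^'r)) set"
  assumes "bounded S"
  shows "\<exists>L. L-lipschitz_on S c_grad"
proof -
  have diff: "\<exists>L. L-lipschitz_on S (\<lambda>z. f z - g z)"
    if "\<exists>L. L-lipschitz_on S f" "\<exists>L. L-lipschitz_on S g" for f g :: "_ \<Rightarrow> real^'r^'r"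
    using that lipschitz_on_diff by blast
  have D: "\<exists>L. L-lipschitz_on S imbalance"
    unfolding imbalance_def[abs_def]
    by (intro diff lipschitz_on_matrix_mul assms lipschitz_on_bounded_linear bounded_linear_fst
        bounded_linear_snd bounded_linear_compose[OF bounded_linear_transpose])
  have "\<exists>L. L-lipschitz_on S (\<lambda>z. fst z ** imbalance z)"
    by (intro lipschitz_on_matrix_mul assms D lipschitz_on_bounded_linear bounded_linear_fst)
  moreover have "\<exists>L. L-lipschitz_on S (\<lambda>z. imbalance z ** snd z)"
    by (intro lipschitz_on_matrix_mul assms D lipschitz_on_bounded_linear bounded_linear_snd)
  ultimately show ?thesis
    unfolding c_grad_def[abs_def] using lipschitz_on_Pair lipschitz_on_minus by blast
qed

section \<open>Gradient of f, and its Hessian on the fibre X Y = M\<close>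

lemma mf_f_inner: "mf_f M z = ((fst z ** snd z - M) \<bullet> (fst z ** snd z - M)) / 2"
  by (simp add: mf_f_def case_prod_unfold power2_norm_eq_inner)

lemma grad_mf_f:
  "grad (mf_f M) z = ((fst z ** snd z - M) ** transpose (snd z), transpose (fst z) ** (fst z ** snd z - M))"
proof (rule grad_eqI)
  let ?X = "fst z" and ?Y = "snd z"
  let ?R = "fst z ** snd z - M" and ?R' = "\<lambda>h. fst z ** snd h + fst h ** snd z"
  have "((\<lambda>z. ((fst z ** snd z - M) \<bullet> (fst z ** snd z - M)) / 2) has_derivative
    (\<lambda>h. (?R \<bullet> ?R' h + ?R' h \<bullet> ?R) / 2)) (at z)"
    by (auto intro!: derivative_eq_intros)
  moreover have "(?R \<bullet> ?R' h + ?R' h \<bullet> ?R) / 2 = h \<bullet> (?R ** transpose ?Y, transpose ?X ** ?R)" for h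
    by (cases h) (simp add: inner_commute[of ?R] inner_add_left inner_matrix_mul_left[of ?X]
        inner_matrix_mul_right[of _ ?Y])
  ultimately show "GDERIV (mf_f M) z :> (?R ** transpose ?Y, transpose ?X ** ?R)"
    unfolding gderiv_def mf_f_inner[abs_def] by simp
qed

text \<open>Differentiating the gradient also hits its outer factors, but those terms carry the
  residual X Y - M, which is zero on the fibre. Only the Gauss-Newton part survives.\<close>

lemma hessian_mf_f:
  assumes "fst z ** snd z = M"
  shows "hessian (mf_f M) z h = ((fst h ** snd z + fst z ** snd h) ** transpose (snd z),
    transpose (fst z) ** (fst h ** snd z + fst z ** snd h))"
proof -
  have "(grad (mf_f M) has_derivative (\<lambda>h. ((fst h ** snd z + fst z ** snd h) ** transpose (snd z),
    transpose (fst z) ** (fst h ** snd z + fst z ** snd h)))) (at z)"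
    unfolding grad_mf_f[abs_def]
    by (auto intro!: derivative_eq_intros simp: assms add.commute mul.zero_left mul.zero_right)
  from fun_cong[OF frechet_derivative_at[OF this], of h] show ?thesis by (simp add: hessian_def)
qed

text \<open>Serves in place of the eigenvalue: it agrees with it on the fibre and is convex on the
  whole space, whereas the product term in \<open>mf_phi\<close> spoils convexity.\<close>

definition spectral_sq :: "(real^'r^'m) \<times> (real^'n^'r) \<Rightarrow> real" where
  "spectral_sq z = (spectral_norm (fst z))\<^sup>2 + (spectral_norm (snd z))\<^sup>2"

text \<open>Bounds the differential of the map (X, Y) -> X Y. Each term mixes a spectral and a
  Frobenius norm, and Cauchy-Schwarz in the plane joins them.\<close>

lemma norm_mul_add_mul_le:
  fixes X :: "real^'r^'m" and Y :: "real^'n^'r"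
  shows "norm (H ** Y + X ** K) \<le> sqrt (spectral_sq (X, Y)) * norm (H, K)"
proof -
  let ?a = "spectral_norm X" and ?b = "spectral_norm Y"
  have "norm (H ** Y + X ** K) \<le> ?b * norm H + ?a * norm K"
    using norm_matrix_mul_right[of H Y] norm_matrix_mul_left[of X K]
    by (intro norm_triangle_le) (simp add: mult.commute)
  also have "\<dots> = (?b, ?a) \<bullet> (norm H, norm K)" by simp
  also have "\<dots> \<le> norm (?b, ?a) * norm (norm H, norm K)" by (rule norm_cauchy_schwarz)
  also have "\<dots> = sqrt (spectral_sq (X, Y)) * norm (H, K)"
    by (simp add: norm_Pair spectral_sq_def add.commute)
  finally show ?thesis .
qed

lemma singular_triples:
  fixes X :: "real^'r^'m" and Y :: "real^'n^'r"
  obtains p v q w where "norm p = 1" "norm v = 1" "norm q = 1" "norm w = 1"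
    "X *v p = spectral_norm X *\<^sub>R v" "transpose X *v v = spectral_norm X *\<^sub>R p"
    "Y *v w = spectral_norm Y *\<^sub>R q" "transpose Y *v q = spectral_norm Y *\<^sub>R w"
proof -
  obtain p where p: "norm p = 1" "norm (X *v p) = spectral_norm X" by (rule spectral_norm_attained)
  obtain v where v: "norm v = 1" "X *v p = spectral_norm X *\<^sub>R v" "transpose X *v v = spectral_norm X *\<^sub>R p"
    using singular_pair[OF p] by blast
  obtain w where w: "norm w = 1" "norm (Y *v w) = spectral_norm Y" by (rule spectral_norm_attained)
  obtain q where q: "norm q = 1" "Y *v w = spectral_norm Y *\<^sub>R q" "transpose Y *v q = spectral_norm Y *\<^sub>R w"
    using singular_pair[OF w] by blast
  show thesis using p v w q that by blast
qed

text \<open>With singular triples \<open>X p = a v\<close> and \<open>Y w = b q\<close>, the top eigenvector is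
  \<open>(b v q\<^sup>T, a p w\<^sup>T)\<close>.\<close>

lemma lambda1_hessian_mf_f:
  fixes z :: "(real^'r^'m) \<times> (real^'n^'r)"
  assumes M: "fst z ** snd z = M"
  shows "lambda1 (hessian (mf_f M) z) = spectral_sq z"
  unfolding lambda1_def
proof (rule Greatest_equality)
  obtain X Y where z: "z = (X, Y)" by (cases z)
  let ?a = "spectral_norm X" and ?b = "spectral_norm Y"
  have hess: "hessian (mf_f M) z (H, K) = ((H ** Y + X ** K) ** transpose Y, transpose X ** (H ** Y + X ** K))" for H K
    using hessian_mf_f[OF M, of "(H, K)"] by (simp add: z)
  show "is_eigenvalue (hessian (mf_f M) z) (spectral_sq z)"
  proof (cases "spectral_sq z = 0")
    \<comment> \<open>Here z = 0 and the singular-vector formula degenerates to 0, but the Hessian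
      vanishes, so any nonzero vector works.\<close>
    case True
    then have "?a = 0" "?b = 0" by (auto simp: z spectral_sq_def add_nonneg_eq_0_iff)
    then have "X = 0" "Y = 0" using norm_le_spectral_norm[of X] norm_le_spectral_norm[of Y] by auto
    moreover obtain h :: "(real^'r^'m) \<times> (real^'n^'r)" where "h \<noteq> 0"
      using nonzero_Basis nonempty_Basis by (metis ex_in_conv)
    moreover have "hessian (mf_f M) z h = 0" for h
      by (cases h) (simp add: hess \<open>X = 0\<close> \<open>Y = 0\<close> mul.zero_left mul.zero_right transpose_0 zero_prod_def)
    ultimately show ?thesis unfolding is_eigenvalue_def True by (intro exI[of _ h]) simp
  next
    case False
    obtain p v q w where n: "norm p = 1" "norm v = 1" "norm q = 1" "norm w = 1"
      and s: "X *v p = ?a *\<^sub>R v" "transpose X *v v = ?a *\<^sub>R p"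
        "Y *v w = ?b *\<^sub>R q" "transpose Y *v q = ?b *\<^sub>R w" by (rule singular_triples)
    let ?h = "(?b *\<^sub>R outer v q, ?a *\<^sub>R outer p w)"
    have sq: "spectral_sq z = ?a\<^sup>2 + ?b\<^sup>2" by (simp add: z spectral_sq_def)
    have eq: "(?b *\<^sub>R outer v q) ** Y + X ** (?a *\<^sub>R outer p w) = (?a\<^sup>2 + ?b\<^sup>2) *\<^sub>R outer v w"
      by (simp add: mul.scaleR_left mul.scaleR_right outer_matrix_mul matrix_mul_outer s
          outer_scaleR_left outer_scaleR_right power2_eq_square algebra_simps)
    have "hessian (mf_f M) z ?h = spectral_sq z *\<^sub>R ?h"
      unfolding hess eq sq
      by (simp add: transpose_outer mul.scaleR_left mul.scaleR_right outer_matrix_mul matrix_mul_outer s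
          outer_scaleR_left outer_scaleR_right)
    moreover have "(norm ?h)\<^sup>2 = spectral_sq z"
      by (simp add: norm_Pair norm_outer n spectral_sq_def z)
    then have "?h \<noteq> 0" using False by auto
    ultimately show ?thesis unfolding is_eigenvalue_def by blast
  qed
  fix l assume "is_eigenvalue (hessian (mf_f M) z) l"
  then obtain h where h: "h \<noteq> 0" "hessian (mf_f M) z h = l *\<^sub>R h" unfolding is_eigenvalue_def by blast
  obtain H K where hk: "h = (H, K)" by (cases h)
  have "l * (norm h)\<^sup>2 = hessian (mf_f M) z h \<bullet> h" by (simp add: h power2_norm_eq_inner)
  also have "\<dots> = (H ** Y + X ** K) \<bullet> (H ** Y + X ** K)"
    unfolding hk hess
    by (simp add: inner_add_right inner_matrix_mul_right[of _ "transpose Y"] inner_matrix_mul_left[of "transpose X"])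
  also have "\<dots> = (norm (H ** Y + X ** K))\<^sup>2" by (simp add: power2_norm_eq_inner)
  also have "\<dots> \<le> (sqrt (spectral_sq z) * norm h)\<^sup>2"
    unfolding hk z by (intro power_mono norm_mul_add_mul_le) simp
  also have "\<dots> = spectral_sq z * (norm h)\<^sup>2"
    by (simp add: power_mult_distrib spectral_sq_def)
  finally show "l \<le> spectral_sq z" using h by simp
qed

section \<open>Directional derivatives and gradient flows\<close>

lemma has_dir_deriv_le:
  assumes d: "has_dir_deriv f x w d" and "\<epsilon> > 0"
    and le: "\<And>\<tau>. 0 < \<tau> \<Longrightarrow> \<tau> < \<epsilon> \<Longrightarrow> f (x + \<tau> *\<^sub>R w) \<le> f x + \<tau> * k + \<tau>\<^sup>2 * C"
  shows "d \<le> k"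
proof (rule tendsto_le)
  show "((\<lambda>\<tau>. k + \<tau> * C) \<longlongrightarrow> k) (at_right 0)"
    by (auto intro!: tendsto_eq_intros)
  show "((\<lambda>\<tau>. (f (x + \<tau> *\<^sub>R w) - f x) / \<tau>) \<longlongrightarrow> d) (at_right 0)"
    using d by (simp add: has_dir_deriv_def)
  have "(f (x + \<tau> *\<^sub>R w) - f x) / \<tau> \<le> k + \<tau> * C" if "0 < \<tau>" "\<tau> < \<epsilon>" for \<tau>
    using le[OF that] that by (simp add: pos_divide_le_eq power2_eq_square algebra_simps)
  then show "\<forall>\<^sub>F \<tau> in at_right 0. (f (x + \<tau> *\<^sub>R w) - f x) / \<tau> \<le> k + \<tau> * C"
    unfolding eventually_at_right_field using \<open>\<epsilon> > 0\<close> by blast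
qed simp

text \<open>Testing with a unit vector \<open>v\<close>, the first-order term is
  \<open>-2 |A\<^sup>T A v|\<^sup>2 + 2 |B A v|\<^sup>2 \<le> -2 |A v|\<^sup>4 + 2 |B A|\<^sup>2\<close>, and \<open>q \<mapsto> q - 2 \<tau> q\<^sup>2\<close> is
  monotone on \<open>[0, |A|\<^sup>2]\<close> for small \<open>\<tau>\<close>.\<close>

lemma spectral_norm_flow_le:
  fixes A :: "real^'k^'r" and B :: "real^'r^'l"
  defines "E \<equiv> A ** transpose A - transpose B ** B"
  assumes \<tau>: "0 < \<tau>" "4 * \<tau> * (spectral_norm A)\<^sup>2 \<le> 1"
  shows "(spectral_norm (A - \<tau> *\<^sub>R (E ** A)))\<^sup>2 \<le> (spectral_norm A)\<^sup>2
    + \<tau> * (2 * (spectral_norm (B ** A))\<^sup>2 - 2 * (spectral_norm A) ^ 4) + \<tau>\<^sup>2 * (norm (E ** A))\<^sup>2"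
proof -
  let ?a = "spectral_norm A" and ?p = "spectral_norm (B ** A)"
  let ?r = "?a\<^sup>2 + \<tau> * (2 * ?p\<^sup>2 - 2 * ?a ^ 4) + \<tau>\<^sup>2 * (norm (E ** A))\<^sup>2"
  obtain v where v: "norm v = 1" "norm ((A - \<tau> *\<^sub>R (E ** A)) *v v) = spectral_norm (A - \<tau> *\<^sub>R (E ** A))"
    by (rule spectral_norm_attained)
  define w where "w = A *v v"
  define q where "q = (norm w)\<^sup>2"
  have "norm w \<le> ?a" using norm_matrix_vector[of A v] v by (simp add: w_def)
  then have q: "0 \<le> q" "q \<le> ?a\<^sup>2" by (auto simp: q_def intro: power_mono)
  have "q = v \<bullet> (transpose A *v w)"
    by (simp add: q_def power2_norm_eq_inner w_def flip: inner_matrix_vector)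
  also have "\<dots> \<le> norm (transpose A *v w)" using norm_cauchy_schwarz[of v "transpose A *v w"] v by simp
  finally have 1: "q\<^sup>2 \<le> (norm (transpose A *v w))\<^sup>2" using q by (intro power_mono)
  have "norm (B *v w) \<le> ?p"
    using norm_matrix_vector[of "B ** A" v] v by (simp add: w_def matrix_vector_mul_assoc)
  then have 2: "(norm (B *v w))\<^sup>2 \<le> ?p\<^sup>2" by (intro power_mono) auto
  have "norm (E *v w) \<le> norm (E ** A)"
    using norm_matrix_vector_frobenius[of "E ** A" v] v by (simp add: w_def matrix_vector_mul_assoc)
  then have 3: "(norm (E *v w))\<^sup>2 \<le> (norm (E ** A))\<^sup>2" by (intro power_mono) auto
  have Ew: "w \<bullet> (E *v w) = (norm (transpose A *v w))\<^sup>2 - (norm (B *v w))\<^sup>2"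
    using inner_matrix_vector[of A "transpose A *v w" w] inner_matrix_vector[of "B" w "B *v w"]
    by (simp add: E_def matrix_vector_mult_diff_rdistrib inner_diff_right power2_norm_eq_inner
        inner_commute flip: matrix_vector_mul_assoc)
  have "(A - \<tau> *\<^sub>R (E ** A)) *v v = w - \<tau> *\<^sub>R (E *v w)"
    by (simp add: w_def matrix_vector_mult_diff_rdistrib matrix_vector_mul_assoc flip: scaleR_matrix_vector_assoc)
  then have "(spectral_norm (A - \<tau> *\<^sub>R (E ** A)))\<^sup>2 = (norm (w - \<tau> *\<^sub>R (E *v w)))\<^sup>2" using v by simp
  also have "\<dots> = q - 2 * \<tau> * (w \<bullet> (E *v w)) + \<tau>\<^sup>2 * (norm (E *v w))\<^sup>2"
    unfolding q_def power2_norm_eq_inner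
    by (simp add: inner_diff inner_commute algebra_simps power2_eq_square)
  also have "\<dots> = q - 2 * \<tau> * (norm (transpose A *v w))\<^sup>2 + 2 * \<tau> * (norm (B *v w))\<^sup>2 + \<tau>\<^sup>2 * (norm (E *v w))\<^sup>2"
    by (simp add: Ew algebra_simps)
  also have "\<dots> \<le> q - 2 * \<tau> * q\<^sup>2 + 2 * \<tau> * ?p\<^sup>2 + \<tau>\<^sup>2 * (norm (E ** A))\<^sup>2"
    using \<tau> 1 2 3 by (intro add_mono diff_mono mult_left_mono) auto
  also have "q - 2 * \<tau> * q\<^sup>2 \<le> ?a\<^sup>2 - 2 * \<tau> * ?a ^ 4"
  proof -
    have "\<tau> * q \<le> \<tau> * ?a\<^sup>2" using q \<tau> by (intro mult_left_mono) auto
    moreover have "2 * \<tau> * (?a\<^sup>2 + q) = 2 * (\<tau> * ?a\<^sup>2) + 2 * (\<tau> * q)" by (simp add: algebra_simps)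
    ultimately have "2 * \<tau> * (?a\<^sup>2 + q) \<le> 1" using \<tau> by linarith
    \<comment> \<open>This product is the difference of the two sides. Its second factor is where
      the step-size bound 4 \<tau> |A|_2^2 \<le> 1 enters, through q \<le> |A|_2^2.\<close>
    then have "0 \<le> (?a\<^sup>2 - q) * (1 - 2 * \<tau> * (?a\<^sup>2 + q))"
      using q by (intro mult_nonneg_nonneg) auto
    then show ?thesis by (simp add: algebra_simps power2_eq_square power4_eq_xxxx)
  qed
  finally show ?thesis by (simp add: algebra_simps)
qed

lemma convex_on_spectral_sq: "convex_on UNIV spectral_sq"
proof (rule convex_onI)
  fix t :: real and z w :: "(real^'r^'m) \<times> (real^'n^'r)" assume t: "0 < t" "t < 1"
  have *: "(spectral_norm ((1 - t) *\<^sub>R A + t *\<^sub>R B))\<^sup>2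
    \<le> (1 - t) * (spectral_norm A)\<^sup>2 + t * (spectral_norm B)\<^sup>2" for A B :: "real^'x^'y"
  proof -
    let ?a = "spectral_norm A" and ?b = "spectral_norm B"
    have "spectral_norm ((1 - t) *\<^sub>R A + t *\<^sub>R B) \<le> (1 - t) * ?a + t * ?b"
      using spectral_norm_triangle[of "(1 - t) *\<^sub>R A" "t *\<^sub>R B"] t by (simp add: spectral_norm_scaleR)
    then have "(spectral_norm ((1 - t) *\<^sub>R A + t *\<^sub>R B))\<^sup>2 \<le> ((1 - t) * ?a + t * ?b)\<^sup>2"
      by (intro power_mono spectral_norm_nonneg)
    also have "\<dots> = (1 - t) * ?a\<^sup>2 + t * ?b\<^sup>2 - t * (1 - t) * (?a - ?b)\<^sup>2"
      by (simp add: power2_eq_square algebra_simps)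
    also have "\<dots> \<le> (1 - t) * ?a\<^sup>2 + t * ?b\<^sup>2" using t by simp
    finally show ?thesis .
  qed
  show "spectral_sq ((1 - t) *\<^sub>R z + t *\<^sub>R w) \<le> (1 - t) * spectral_sq z + t * spectral_sq w"
    using *[of "fst z" "fst w"] *[of "snd z" "snd w"] by (simp add: spectral_sq_def algebra_simps)
qed simp

lemma spectral_norm_diff_le: "\<bar>spectral_norm A - spectral_norm B\<bar> \<le> norm (A - B :: real^'b^'a)"
proof -
  have "spectral_norm A \<le> spectral_norm B + norm (A - B)" for A B :: "real^'b^'a"
    using spectral_norm_triangle[of "A - B" B] spectral_norm_le_norm[of "A - B"] by simp
  from this[of A B] this[of B A] show ?thesis by (simp add: norm_minus_commute abs_le_iff)
qed

lemma lipschitz_on_spectral_sq: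
  assumes "R \<ge> 0"
  shows "(4 * R)-lipschitz_on (cball (0 :: (real^'r^'m) \<times> (real^'n^'r)) R) spectral_sq"
proof (rule lipschitz_onI)
  fix z w :: "(real^'r^'m) \<times> (real^'n^'r)" assume "z \<in> cball 0 R" "w \<in> cball 0 R"
  then have R: "norm z \<le> R" "norm w \<le> R" by auto
  have *: "\<bar>(spectral_norm A)\<^sup>2 - (spectral_norm B)\<^sup>2\<bar> \<le> 2 * R * d"
    if "norm A \<le> R" "norm B \<le> R" "norm (A - B) \<le> d" for A B :: "real^'x^'y" and d
  proof -
    have "spectral_norm A + spectral_norm B \<le> 2 * R"
      using that spectral_norm_le_norm[of A] spectral_norm_le_norm[of B] by linarith
    moreover have "\<bar>spectral_norm A - spectral_norm B\<bar> \<le> d"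
      using spectral_norm_diff_le[of A B] that by linarith
    moreover have "\<bar>(spectral_norm A)\<^sup>2 - (spectral_norm B)\<^sup>2\<bar>
      = (spectral_norm A + spectral_norm B) * \<bar>spectral_norm A - spectral_norm B\<bar>"
      using spectral_norm_nonneg[of A] spectral_norm_nonneg[of B]
      by (simp add: power2_eq_square square_diff_square_factored abs_mult)
    ultimately show ?thesis using assms spectral_norm_nonneg[of A] spectral_norm_nonneg[of B]
      by (simp add: mult_mono)
  qed
  have "norm (fst z) \<le> R" "norm (fst w) \<le> R" "norm (snd z) \<le> R" "norm (snd w) \<le> R"
    using R norm_fst_le[of "fst z" "snd z"] norm_fst_le[of "fst w" "snd w"]
      norm_snd_le[of "snd z" "fst z"] norm_snd_le[of "snd w" "fst w"] by simp_all
  moreover have "norm (fst z - fst w) \<le> dist z w" "norm (snd z - snd w) \<le> dist z w"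
    using norm_fst_le[of "fst (z - w)" "snd (z - w)"] norm_snd_le[of "snd (z - w)" "fst (z - w)"]
    unfolding dist_norm fst_diff[symmetric] snd_diff[symmetric] prod.collapse by auto
  ultimately show "dist (spectral_sq z) (spectral_sq w) \<le> 4 * R * dist z w"
    using *[of "fst z" "fst w" "dist z w"] *[of "snd z" "snd w" "dist z w"]
    unfolding spectral_sq_def dist_real_def by linarith
qed (use assms in simp)

lemma mf_phi_spectral_sq: "mf_phi z = spectral_sq z - 2 * spectral_norm (fst z ** snd z)"
  by (simp add: mf_phi_def spectral_sq_def case_prod_unfold)

text \<open>\<open>mf_phi\<close> is (a - b)^2 + 2 (a b - |X Y|_2) for the spectral norms a of X and
  b of Y.\<close>

lemma mf_phi_nonneg: "mf_phi z \<ge> 0"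
proof -
  have "0 \<le> (spectral_norm (fst z) - spectral_norm (snd z))\<^sup>2" by simp
  then show ?thesis
    using spectral_norm_mul_le[of "fst z" "snd z"]
    by (simp add: mf_phi_spectral_sq spectral_sq_def power2_eq_square algebra_simps)
qed

text \<open>Convexity gives the derivative. Its size is read off an Euler step, bounded by
  \<open>spectral_norm_flow_le\<close> once for (X^T, Y^T) and once for (Y, X): both factors obey
  the same law with opposite signs of D.\<close>

lemma spectral_sq_dir_deriv_c_grad:
  obtains d where "has_dir_deriv spectral_sq z (- c_grad z) d" "d \<le> - (mf_phi z)\<^sup>2"
proof -
  let ?X = "fst z" and ?Y = "snd z" and ?D = "imbalance z"
  let ?a = "spectral_norm ?X" and ?b = "spectral_norm ?Y" and ?p = "spectral_norm (?X ** ?Y)"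
  obtain d where d: "has_dir_deriv spectral_sq z (- c_grad z) d"
    using convex_has_dir_deriv[OF convex_on_spectral_sq] by blast
  \<comment> \<open>Makes 4 \<tau> a^2 \<le> 1 and 4 \<tau> b^2 \<le> 1 at once; the summand 1 keeps
    the denominator positive.\<close>
  define \<epsilon> where "\<epsilon> = 1 / (4 * (1 + ?a\<^sup>2 + ?b\<^sup>2))"
  have pos: "1 + ?a\<^sup>2 + ?b\<^sup>2 > 0" by (simp add: add_pos_nonneg)
  then have "\<epsilon> > 0" by (simp add: \<epsilon>_def)
  define C where "C = (norm (?D ** transpose ?X))\<^sup>2 + (norm (?D ** ?Y))\<^sup>2"
  have "spectral_sq (z + \<tau> *\<^sub>R (- c_grad z)) \<le> spectral_sq z + \<tau> * (4 * ?p\<^sup>2 - 2 * ?a ^ 4 - 2 * ?b ^ 4) + \<tau>\<^sup>2 * C"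
    if \<tau>: "0 < \<tau>" "\<tau> < \<epsilon>" for \<tau>
  proof -
    have "\<tau> * (4 * (1 + ?a\<^sup>2 + ?b\<^sup>2)) \<le> 1" using \<tau> pos by (simp add: \<epsilon>_def field_simps)
    moreover have "\<tau> * (4 * (1 + ?a\<^sup>2 + ?b\<^sup>2)) = 4 * \<tau> + 4 * \<tau> * ?a\<^sup>2 + 4 * \<tau> * ?b\<^sup>2"
      by (simp add: algebra_simps)
    moreover have "0 \<le> 4 * \<tau> * ?a\<^sup>2" "0 \<le> 4 * \<tau> * ?b\<^sup>2" using \<tau> by auto
    ultimately have small: "4 * \<tau> * ?a\<^sup>2 \<le> 1" "4 * \<tau> * ?b\<^sup>2 \<le> 1" using \<tau> by linarith+
    have "transpose (?X - \<tau> *\<^sub>R (?X ** ?D)) = transpose ?X - \<tau> *\<^sub>R (?D ** transpose ?X)"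
      by (simp add: transpose_diff transpose_scalar matrix_transpose_mul)
    then have eq1: "spectral_norm (?X - \<tau> *\<^sub>R (?X ** ?D)) = spectral_norm (transpose ?X - \<tau> *\<^sub>R (?D ** transpose ?X))"
      by (metis spectral_norm_transpose)
    have "spectral_norm (transpose ?Y ** transpose ?X) = ?p"
      by (metis matrix_transpose_mul spectral_norm_transpose)
    then have 1: "(spectral_norm (?X - \<tau> *\<^sub>R (?X ** ?D)))\<^sup>2 \<le> ?a\<^sup>2 + \<tau> * (2 * ?p\<^sup>2 - 2 * ?a ^ 4) + \<tau>\<^sup>2 * (norm (?D ** transpose ?X))\<^sup>2"
      using spectral_norm_flow_le[of \<tau> "transpose ?X" "transpose ?Y"] \<tau> small(1)
      unfolding eq1 by (simp add: imbalance_def)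
    have neg: "?Y ** transpose ?Y - transpose ?X ** ?X = - ?D" by (simp add: imbalance_def)
    have 2: "(spectral_norm (?Y + \<tau> *\<^sub>R (?D ** ?Y)))\<^sup>2 \<le> ?b\<^sup>2 + \<tau> * (2 * ?p\<^sup>2 - 2 * ?b ^ 4) + \<tau>\<^sup>2 * (norm (?D ** ?Y))\<^sup>2"
      using spectral_norm_flow_le[of \<tau> ?Y ?X] \<tau> small(2) unfolding neg by (simp add: mul.minus_left)
    show ?thesis using 1 2 by (simp add: spectral_sq_def c_grad_def C_def algebra_simps)
  qed
  from has_dir_deriv_le[OF d \<open>\<epsilon> > 0\<close> this] have "d \<le> 4 * ?p\<^sup>2 - 2 * ?a ^ 4 - 2 * ?b ^ 4" .
  also have "\<dots> \<le> - (mf_phi z)\<^sup>2"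
  proof -
    define S P Q where "S = ?a\<^sup>2" and "P = ?b\<^sup>2" and "Q = ?p"
    have "0 \<le> Q" by (simp add: Q_def spectral_norm_nonneg)
    have "2 * Q \<le> S + P"
      using mf_phi_nonneg[of z] by (simp add: S_def P_def Q_def mf_phi_spectral_sq spectral_sq_def)
    \<comment> \<open>Exactly the amount by which -(S + P - 2 Q)^2 exceeds 4 Q^2 - 2 S^2 - 2
      P^2.\<close>
    then have "0 \<le> 4 * Q * (S + P - 2 * Q) + (S - P)\<^sup>2" using \<open>0 \<le> Q\<close> by simp
    then have "4 * Q\<^sup>2 - 2 * S\<^sup>2 - 2 * P\<^sup>2 \<le> - (S + P - 2 * Q)\<^sup>2"
      by (simp add: power2_eq_square algebra_simps)
    moreover have "?a ^ 4 = S\<^sup>2" "?b ^ 4 = P\<^sup>2" by (simp_all add: S_def P_def flip: power_mult)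
    moreover have "mf_phi z = S + P - 2 * Q"
      by (simp add: mf_phi_spectral_sq spectral_sq_def S_def P_def Q_def)
    ultimately show ?thesis unfolding Q_def[symmetric] by simp
  qed
  finally show thesis using d that by blast
qed

text \<open>In (X - \<tau> X D)(Y + \<tau> D Y) the first-order terms cancel, so |X Y|_2 changes by
  O(\<tau>^2) and \<open>mf_phi\<close> inherits the derivative of
  \<open>spectral_sq\<close>.\<close>

lemma mf_phi_dir_deriv_c_grad:
  obtains d where "has_dir_deriv mf_phi z (- c_grad z) d" "d \<le> - (mf_phi z)\<^sup>2"
proof -
  let ?X = "fst z" and ?Y = "snd z" and ?D = "imbalance z"
  let ?N = "\<lambda>w. spectral_norm (fst w ** snd w)"
  let ?q = "\<lambda>\<tau>. (?N (z + \<tau> *\<^sub>R (- c_grad z)) - ?N z) / \<tau>"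
  obtain d where d: "has_dir_deriv spectral_sq z (- c_grad z) d" "d \<le> - (mf_phi z)\<^sup>2"
    by (rule spectral_sq_dir_deriv_c_grad)
  let ?W = "(?X ** ?D) ** (?D ** ?Y)"
  have prod: "fst (z + \<tau> *\<^sub>R (- c_grad z)) ** snd (z + \<tau> *\<^sub>R (- c_grad z)) = ?X ** ?Y - \<tau>\<^sup>2 *\<^sub>R ?W" for \<tau>
    by (simp add: c_grad_def mul.add_left mul.add_right mul.diff_left mul.scaleR_left mul.scaleR_right
        matrix_mul_assoc power2_eq_square algebra_simps)
  have "norm (?q \<tau>) \<le> \<bar>\<tau>\<bar> * norm ?W" for \<tau>
  proof -
    have "\<bar>?N (z + \<tau> *\<^sub>R (- c_grad z)) - ?N z\<bar> \<le> \<tau>\<^sup>2 * norm ?W"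
      unfolding prod using spectral_norm_diff_le[of "?X ** ?Y - \<tau>\<^sup>2 *\<^sub>R ?W" "?X ** ?Y"] by simp
    also have "\<dots> = \<bar>\<tau>\<bar> * norm ?W * \<bar>\<tau>\<bar>" by (simp add: power2_eq_square)
    finally show ?thesis by (cases "\<tau> = 0") (auto simp: pos_divide_le_eq)
  qed
  moreover have "((\<lambda>\<tau>. \<bar>\<tau>\<bar> * norm ?W) \<longlongrightarrow> 0) (at_right 0)"
    by (auto intro!: tendsto_eq_intros)
  ultimately have "(?q \<longlongrightarrow> 0) (at_right 0)"
    by (intro Lim_null_comparison[of ?q "\<lambda>\<tau>. \<bar>\<tau>\<bar> * norm ?W"]) auto
  then have "((\<lambda>\<tau>. (spectral_sq (z + \<tau> *\<^sub>R (- c_grad z)) - spectral_sq z) / \<tau> - 2 * ?q \<tau>) \<longlongrightarrow> d - 2 * 0) (at_right 0)"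
    using d(1) unfolding has_dir_deriv_def by (intro tendsto_intros)
  then have "has_dir_deriv mf_phi z (- c_grad z) d"
    unfolding has_dir_deriv_def mf_phi_spectral_sq by (simp add: diff_divide_distrib add_divide_distrib algebra_simps)
  then show thesis using d(2) that by blast
qed

section \<open>Gradient flows under a Lojasiewicz inequality\<close>

lemma gderiv_along_curve:
  assumes "GDERIV c (x r) :> g" "(x has_vector_derivative v) (at r within S)"
  shows "((\<lambda>r. c (x r)) has_real_derivative v \<bullet> g) (at r within S)"
  using has_derivative_compose[OF assms(2)[unfolded has_vector_derivative_def] assms(1)[unfolded gderiv_def]]
  by (rule has_derivative_imp_has_field_derivative) simp

lemma gradient_flow_decreasing:
  assumes sol: "global_solution (\<lambda>z. - g z) x0 x" and g: "\<And>z. GDERIV c z :> g z" and st: "0 \<le> s" "s \<le> t"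
  shows "c (x t) \<le> c (x s)"
proof (rule right_derivative_nonpos_imp_le[OF st(2)])
  have "continuous_on UNIV c"
    using g by (auto intro!: has_derivative_continuous_on simp: gderiv_def)
  moreover have "continuous_on {s..t} x"
    using global_solution_continuous[OF sol] st by (auto intro: continuous_on_subset)
  ultimately show "continuous_on {s..t} (\<lambda>r. c (x r))" by (auto intro: continuous_on_compose2)
  fix r assume "s \<le> r" "r < t"
  then have "((\<lambda>r. c (x r)) has_real_derivative - g (x r) \<bullet> g (x r)) (at_right r)"
    using st by (intro gderiv_along_curve[OF g] global_solution_right[OF sol]) simp
  then show "\<exists>d\<le>0. ((\<lambda>r. c (x r)) has_real_derivative d) (at_right r)"
    by (intro exI[of _ "- g (x r) \<bullet> g (x r)"]) simp
qed

text \<open>The Lojasiewicz inequality makes \<open>(4 / k) c(x)\<^bsup>1/4\<^esup>\<close> decrease at least as fast as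
  arc length grows.\<close>

lemma lojasiewicz_length_bound:
  fixes x :: "real \<Rightarrow> 'a::euclidean_space"
  assumes sol: "global_solution (\<lambda>z. - g z) x0 x" and g: "\<And>z. GDERIV c z :> g z"
    and "k > 0" and loj: "\<And>z. k * c z powr (3/4) \<le> norm (g z)"
    and st: "0 \<le> s" "s \<le> t" and pos: "\<And>r. s \<le> r \<Longrightarrow> r \<le> t \<Longrightarrow> c (x r) > 0"
  shows "norm (x t - x s) \<le> 4 / k * (c (x s) powr (1/4) - c (x t) powr (1/4))"
proof -
  \<comment> \<open>Testing against the direction of the displacement makes the length estimate a
    scalar monotonicity statement.\<close>
  define e where "e = sgn (x t - x s)"
  let ?h = "\<lambda>r. e \<bullet> x r + 4 / k * c (x r) powr (1/4)"
  have "?h t \<le> ?h s"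
  proof (rule right_derivative_nonpos_imp_le[OF st(2)])
    have cx: "continuous_on {s..t} x"
      using global_solution_continuous[OF sol] st by (auto intro: continuous_on_subset)
    have "continuous_on UNIV c"
      using g by (auto intro!: has_derivative_continuous_on simp: gderiv_def)
    then have "continuous_on {s..t} (\<lambda>r. c (x r))" using cx by (auto intro: continuous_on_compose2)
    then show "continuous_on {s..t} ?h"
      using pos cx by (intro continuous_intros) force+
    fix r assume r: "s \<le> r" "r < t"
    then have cr: "c (x r) > 0" using pos by simp
    let ?g = "norm (g (x r))"
    have dx: "(x has_vector_derivative - g (x r)) (at_right r)"
      using r st by (intro global_solution_right[OF sol]) simp
    have "((\<lambda>r. c (x r)) has_real_derivative - g (x r) \<bullet> g (x r)) (at_right r)"
      by (rule gderiv_along_curve[OF g dx])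
    from DERIV_chain2[OF has_real_derivative_powr[OF cr] this, of "1/4"]
    have 1: "((\<lambda>r. c (x r) powr (1/4)) has_real_derivative
        1/4 * c (x r) powr (1/4 - 1) * (- g (x r) \<bullet> g (x r))) (at_right r)" .
    have 2: "((\<lambda>r. e \<bullet> x r) has_real_derivative e \<bullet> (- g (x r))) (at_right r)"
      using has_real_derivative_inner[OF has_vector_derivative_const dx] by simp
    have d: "(?h has_real_derivative e \<bullet> (- g (x r))
        + 4 / k * (1/4 * c (x r) powr (1/4 - 1) * (- g (x r) \<bullet> g (x r)))) (at_right r)"
      by (intro DERIV_add 2 DERIV_cmult 1)
    have "c (x r) powr (1/4 - 1) * c (x r) powr (3/4) = 1"
      using cr by (simp flip: powr_add)
    moreover have "c (x r) powr (1/4 - 1) * (k * c (x r) powr (3/4)) \<le> c (x r) powr (1/4 - 1) * ?g"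
      by (intro mult_left_mono loj) simp
    ultimately have "k \<le> c (x r) powr (1/4 - 1) * ?g" by (simp add: mult.left_commute)
    then have "k * ?g \<le> c (x r) powr (1/4 - 1) * ?g * ?g" by (intro mult_right_mono) auto
    then have "?g \<le> 1 / k * (c (x r) powr (1/4 - 1) * (g (x r) \<bullet> g (x r)))"
      using \<open>k > 0\<close> by (simp add: field_simps power2_eq_square flip: power2_norm_eq_inner)
    moreover have "e \<bullet> (- g (x r)) \<le> norm e * ?g" using norm_cauchy_schwarz[of e "- g (x r)"] by simp
    moreover have "norm e * ?g \<le> 1 * ?g" by (intro mult_right_mono) (auto simp: e_def norm_sgn)
    ultimately have "e \<bullet> (- g (x r)) + 4 / k * (1/4 * c (x r) powr (1/4 - 1) * (- g (x r) \<bullet> g (x r))) \<le> 0"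
      by simp
    with d show "\<exists>d\<le>0. (?h has_real_derivative d) (at_right r)" by blast
  qed
  moreover have "e \<bullet> (x t - x s) = norm (x t - x s)"
    by (cases "x t = x s") (simp_all add: e_def sgn_div_norm power2_eq_square flip: power2_norm_eq_inner)
  ultimately show ?thesis by (simp add: inner_diff_right right_diff_distrib)
qed

text \<open>The length bound differentiates c^(1/4) and so asks for c > 0, hence the case split. If
  c vanishes at some time, it stays 0 and the trajectory rests; otherwise the bound telescopes along
  the decreasing c^(1/4) and yields a Cauchy property.\<close>

lemma lojasiewicz_flow_converges:
  fixes x :: "real \<Rightarrow> 'a::euclidean_space"
  assumes sol: "global_solution (\<lambda>z. - g z) x0 x" and g: "\<And>z. GDERIV c z :> g z"
    and "k > 0" and loj: "\<And>z. k * c z powr (3/4) \<le> norm (g z)"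
    and nonneg: "\<And>z. c z \<ge> 0" and zero: "\<And>z. c z = 0 \<Longrightarrow> g z = 0"
  obtains l where "(x \<longlongrightarrow> l) at_top"
proof (cases "\<exists>s\<ge>0. c (x s) = 0")
  case True
  then obtain s where s: "s \<ge> 0" "c (x s) = 0" by blast
  have "x t = x s" if "s \<le> t" for t
  proof -
    have "(x t - x s) \<bullet> x t \<le> (x t - x s) \<bullet> x s"
    proof (rule right_derivative_nonpos_imp_le[OF that])
      show "continuous_on {s..t} (\<lambda>r. (x t - x s) \<bullet> x r)"
        using global_solution_continuous[OF sol] s by (intro continuous_intros) (auto intro: continuous_on_subset)
      fix r assume "s \<le> r" "r < t"
      then have "c (x r) = 0"
        using gradient_flow_decreasing[OF sol g s(1), of r] s(2) nonneg[of "x r"] by simp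
      then have "(x has_vector_derivative 0) (at_right r)"
        using global_solution_right[OF sol, of r] zero[of "x r"] s \<open>s \<le> r\<close> by simp
      then show "\<exists>d\<le>0. ((\<lambda>r. (x t - x s) \<bullet> x r) has_real_derivative d) (at_right r)"
        using has_real_derivative_inner[OF has_vector_derivative_const] by force
    qed
    then have "(x t - x s) \<bullet> (x t - x s) \<le> 0" by (simp add: inner_diff_right)
    then show ?thesis by (metis inner_ge_zero inner_eq_zero_iff order_antisym right_minus_eq)
  qed
  then have "\<forall>\<^sub>F t in at_top. x t = x s" by (intro eventually_mono[OF eventually_ge_at_top[of s]])
  then show ?thesis by (intro that[of "x s"] tendsto_eventually)
next
  case False
  define u where "u t = c (x t) powr (1/4)" for t
  have pos: "c (x r) > 0" if "r \<ge> 0" for r using False nonneg[of "x r"] that by (metis order_le_less)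
  have len: "norm (x t - x s) \<le> 4 / k * (u s - u t)" if "0 \<le> s" "s \<le> t" for s t
    unfolding u_def using that pos by (intro lojasiewicz_length_bound[OF sol g \<open>k > 0\<close> loj]) auto
  have mono: "u t \<le> u s" if "0 \<le> s" "s \<le> t" for s t
    unfolding u_def using that gradient_flow_decreasing[OF sol g that] nonneg by (intro powr_mono2) auto
  have "decseq (\<lambda>n. u (real n))" by (auto simp: decseq_def intro: mono)
  then obtain U where U: "(\<lambda>n. u (real n)) \<longlonglongrightarrow> U" "\<And>n. U \<le> u (real n)"
    using decseq_convergent[of "\<lambda>n. u (real n)" 0] by (auto simp: u_def)
  have Ut: "U \<le> u t" if "t \<ge> 0" for t
    using U(2)[of "nat \<lceil>t\<rceil>"] mono[of t "real (nat \<lceil>t\<rceil>)"] that by (meson order_trans real_nat_ceiling_ge)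
  have tail: "norm (x t - x (real n)) \<le> 4 / k * (u (real n) - U)" if "real n \<le> t" for n t
  proof -
    have "norm (x t - x (real n)) \<le> 4 / k * (u (real n) - u t)" using len that by simp
    also have "\<dots> \<le> 4 / k * (u (real n) - U)"
      using Ut[of t] that \<open>k > 0\<close> by (intro mult_left_mono) auto
    finally show ?thesis .
  qed
  have lim0: "(\<lambda>n. 4 / k * (u (real n) - U)) \<longlonglongrightarrow> 0"
    using tendsto_mult[OF tendsto_const tendsto_diff[OF U(1) tendsto_const], of "4 / k" U] by simp
  have "Cauchy (\<lambda>n. x (real n))"
  proof (rule metric_CauchyI)
    fix e :: real assume "e > 0"
    then obtain N where N: "4 / k * (u (real N) - U) < e / 2"
      using order_tendstoD(2)[OF lim0, of "e / 2"] by (auto simp: eventually_sequentially)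
    have "dist (x (real m)) (x (real n)) < e" if "m \<ge> N" "n \<ge> N" for m n
    proof -
      have "dist (x (real m)) (x (real n)) \<le> norm (x (real m) - x (real N)) + norm (x (real n) - x (real N))"
        using dist_triangle2[of "x (real m)" "x (real n)" "x (real N)"] by (simp add: dist_norm)
      moreover have "norm (x (real m) - x (real N)) \<le> 4 / k * (u (real N) - U)"
        and "norm (x (real n) - x (real N)) \<le> 4 / k * (u (real N) - U)"
        using that by (intro tail, simp)+
      ultimately show ?thesis using N by linarith
    qed
    then show "\<exists>M. \<forall>m\<ge>M. \<forall>n\<ge>M. dist (x (real m)) (x (real n)) < e" by blast
  qed
  then obtain l where l: "(\<lambda>n. x (real n)) \<longlonglongrightarrow> l" using Cauchy_convergent convergentD by blast
  let ?m = "\<lambda>t::real. nat \<lfloor>t\<rfloor>"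
  have m: "filterlim ?m sequentially at_top"
    by (intro filterlim_compose[OF filterlim_nat_sequentially filterlim_floor_sequentially])
  have "((\<lambda>t. x t - x (real (?m t))) \<longlongrightarrow> 0) at_top"
  proof (rule Lim_null_comparison)
    show "((\<lambda>t. 4 / k * (u (real (?m t)) - U)) \<longlongrightarrow> 0) at_top"
      by (rule filterlim_compose[OF lim0 m])
    show "\<forall>\<^sub>F t in at_top. norm (x t - x (real (?m t))) \<le> 4 / k * (u (real (?m t)) - U)"
      using eventually_ge_at_top[of 0] by eventually_elim (intro tail, simp)
  qed
  from tendsto_add[OF this filterlim_compose[OF l m]] have "(x \<longlongrightarrow> l) at_top" by simp
  then show ?thesis by (rule that)
qed

text \<open>Were v l nonzero, <v l, v (x t)> would eventually exceed half of |v l|^2, so <v l, x t>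
  would grow linearly, against convergence.\<close>

lemma global_solution_limit_equilibrium:
  fixes x :: "real \<Rightarrow> 'a::real_inner"
  assumes sol: "global_solution v x0 x" and l: "(x \<longlongrightarrow> l) at_top" and cont: "isCont v l"
  shows "v l = 0"
proof (rule ccontr)
  assume "v l \<noteq> 0"
  define \<delta> where "\<delta> = (v l \<bullet> v l) / 2"
  have "\<delta> > 0" using \<open>v l \<noteq> 0\<close> by (simp add: \<delta>_def)
  have "((\<lambda>t. v l \<bullet> v (x t)) \<longlongrightarrow> v l \<bullet> v l) at_top"
    by (intro tendsto_intros isCont_tendsto_compose[OF cont l])
  moreover have "\<delta> < v l \<bullet> v l" using \<open>\<delta> > 0\<close> unfolding \<delta>_def by simp
  ultimately have "\<forall>\<^sub>F t in at_top. \<delta> < v l \<bullet> v (x t)" by (rule order_tendstoD)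
  then obtain T0 where T0: "\<And>t. t \<ge> T0 \<Longrightarrow> \<delta> < v l \<bullet> v (x t)" by (auto simp: eventually_at_top_linorder)
  define T where "T = max 0 T0"
  have grow: "v l \<bullet> x T + \<delta> * (t - T) \<le> v l \<bullet> x t" if "T \<le> t" for t
  proof -
    have "\<delta> * t - v l \<bullet> x t \<le> \<delta> * T - v l \<bullet> x T"
    proof (rule right_derivative_nonpos_imp_le[OF that])
      show "continuous_on {T..t} (\<lambda>r. \<delta> * r - v l \<bullet> x r)"
        using global_solution_continuous[OF sol]
        by (intro continuous_intros) (auto intro: continuous_on_subset simp: T_def)
      fix r assume "T \<le> r" "r < t"
      then have "(x has_vector_derivative v (x r)) (at_right r)"
        by (intro global_solution_right[OF sol]) (simp add: T_def)
      from has_real_derivative_inner[OF has_vector_derivative_const this]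
      have "((\<lambda>r. v l \<bullet> x r) has_real_derivative v l \<bullet> v (x r)) (at_right r)" by simp
      then have "((\<lambda>r. \<delta> * r - v l \<bullet> x r) has_real_derivative \<delta> - v l \<bullet> v (x r)) (at_right r)"
        by (auto intro!: derivative_eq_intros)
      then show "\<exists>d\<le>0. ((\<lambda>r. \<delta> * r - v l \<bullet> x r) has_real_derivative d) (at_right r)"
        using T0[of r] \<open>T \<le> r\<close> by (intro exI[of _ "\<delta> - v l \<bullet> v (x r)"]) (simp add: T_def)
    qed
    then show ?thesis by (simp add: algebra_simps)
  qed
  have "((\<lambda>t. v l \<bullet> x t) \<longlongrightarrow> v l \<bullet> l) at_top" by (intro tendsto_intros l)
  then have "\<forall>\<^sub>F t in at_top. v l \<bullet> x t < v l \<bullet> l + 1" by (rule order_tendstoD) simp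
  moreover have "\<forall>\<^sub>F t in at_top. T + (v l \<bullet> l + 1 - v l \<bullet> x T) / \<delta> \<le> t" by (rule eventually_ge_at_top)
  moreover have "\<forall>\<^sub>F t in at_top. T \<le> t" by (rule eventually_ge_at_top)
  ultimately have "\<forall>\<^sub>F t in at_top :: real filter. False"
  proof eventually_elim
    case (elim t)
    then have "v l \<bullet> l + 1 - v l \<bullet> x T \<le> \<delta> * (t - T)" using \<open>\<delta> > 0\<close> by (simp add: field_simps)
    then show False using grow[of t] elim by simp
  qed
  then show False by simp
qed

text \<open>If \<open>u\<close> is a unit eigenvector of \<open>D = imbalance z\<close> for an eigenvalue \<open>l\<close> of largest modulus, then
  \<open>|X D|\<^sup>2 + |D Y|\<^sup>2 \<ge> l\<^sup>2 (|X u|\<^sup>2 + |Y\<^sup>T u|\<^sup>2) \<ge> l\<^sup>2 |u \<bullet> D u| = |l|\<^sup>3\<close>.\<close>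

lemma c_grad_lower_bound: "(spectral_norm (imbalance z)) ^ 3 \<le> (norm (c_grad z))\<^sup>2"
proof -
  let ?X = "fst z" and ?Y = "snd z" and ?D = "imbalance z"
  obtain u l where u: "norm u = 1" "?D *v u = l *\<^sub>R u" "\<bar>l\<bar> = spectral_norm ?D"
    using symmetric_extreme_eigenvector[OF transpose_imbalance] by blast
  have "u \<bullet> (?D *v u) = (norm (?X *v u))\<^sup>2 - (norm (transpose ?Y *v u))\<^sup>2"
    using inner_matrix_vector[of ?X u "?X *v u"] inner_matrix_vector[of ?Y "transpose ?Y *v u" u]
    by (simp add: imbalance_def matrix_vector_mult_diff_rdistrib inner_diff_right power2_norm_eq_inner
        inner_commute flip: matrix_vector_mul_assoc)
  moreover have "u \<bullet> (?D *v u) = l" using u by (simp add: flip: power2_norm_eq_inner)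
  ultimately have "\<bar>l\<bar> \<le> (norm (?X *v u))\<^sup>2 + (norm (transpose ?Y *v u))\<^sup>2"
    by (smt (verit) zero_le_power2)
  then have "\<bar>l\<bar> ^ 3 \<le> \<bar>l\<bar>\<^sup>2 * ((norm (?X *v u))\<^sup>2 + (norm (transpose ?Y *v u))\<^sup>2)"
    by (simp add: power3_eq_cube power2_eq_square mult_left_mono flip: mult.assoc)
  also have "\<dots> = (norm ((?X ** ?D) *v u))\<^sup>2 + (norm (transpose (?D ** ?Y) *v u))\<^sup>2"
    by (simp add: u matrix_transpose_mul matrix_vector_mult_scaleR power_mult_distrib distrib_left
        flip: matrix_vector_mul_assoc)
  also have "\<dots> \<le> (norm (?X ** ?D))\<^sup>2 + (norm (?D ** ?Y))\<^sup>2"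
    using norm_matrix_vector_frobenius[of "?X ** ?D" u] norm_matrix_vector_frobenius[of "transpose (?D ** ?Y)" u] u
    by (intro add_mono power_mono) auto
  also have "\<dots> = (norm (c_grad z))\<^sup>2" by (simp add: c_grad_def norm_Pair)
  finally show ?thesis using u by simp
qed

lemma lojasiewicz_mf_c:
  obtains k where "k > 0" "\<And>z :: (real^'r^'m) \<times> (real^'n^'r). k * mf_c z powr (3/4) \<le> norm (c_grad z)"
proof -
  \<comment> \<open>Chosen so that c = (|D| / 2)^2 \<le> (\<kappa> |D|_2)^2; taking the power 3/4
    then produces the constant \<kappa>^(-3/2).\<close>
  define \<kappa> where "\<kappa> = sqrt (real CARD('r)) / 2"
  have "\<kappa> > 0" by (simp add: \<kappa>_def)
  have "\<kappa> powr (- (3/2)) * mf_c z powr (3/4) \<le> norm (c_grad z)" for z :: "(real^'r^'m) \<times> (real^'n^'r)"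
  proof (cases "mf_c z = 0")
    case False
    let ?d = "spectral_norm (imbalance z)"
    have "mf_c z = (norm (imbalance z) / 2)\<^sup>2"
      by (simp add: mf_c_imbalance power_divide power2_norm_eq_inner)
    also have "\<dots> \<le> (\<kappa> * ?d)\<^sup>2"
      using norm_le_spectral_norm[of "imbalance z"] by (intro power_mono) (auto simp: \<kappa>_def)
    finally have le: "mf_c z \<le> (\<kappa> * ?d)\<^sup>2" .
    have "?d > 0"
    proof (rule ccontr)
      assume "\<not> ?d > 0"
      then have "?d = 0" using spectral_norm_nonneg[of "imbalance z"] by simp
      then show False using le mf_c_nonneg[of z] False by simp
    qed
    have "mf_c z powr (3/4) \<le> ((\<kappa> * ?d)\<^sup>2) powr (3/4)"
      using le mf_c_nonneg[of z] by (intro powr_mono2) auto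
    also have "\<dots> = (\<kappa> * ?d) powr (3/2)"
      using \<open>\<kappa> > 0\<close> \<open>?d > 0\<close> by (simp add: powr_powr flip: powr_numeral)
    also have "\<dots> = \<kappa> powr (3/2) * ?d powr (3/2)"
      using \<open>\<kappa> > 0\<close> \<open>?d > 0\<close> by (simp add: powr_mult)
    finally have "\<kappa> powr (- (3/2)) * mf_c z powr (3/4) \<le> \<kappa> powr (- (3/2)) * (\<kappa> powr (3/2) * ?d powr (3/2))"
      by (intro mult_left_mono) auto
    also have "\<dots> = ?d powr (3/2)" using \<open>\<kappa> > 0\<close> by (simp add: powr_minus)
    also have "\<dots> \<le> norm (c_grad z)"
    proof (rule power2_le_imp_le)
      have "(?d powr (3/2))\<^sup>2 = ?d ^ 3"
        using \<open>?d > 0\<close> by (simp add: powr_powr flip: powr_numeral)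
      then show "(?d powr (3/2))\<^sup>2 \<le> (norm (c_grad z))\<^sup>2" using c_grad_lower_bound[of z] by simp
    qed simp
    finally show ?thesis .
  qed simp
  then show thesis using that \<open>\<kappa> > 0\<close> by (metis powr_gt_zero order_less_irrefl)
qed

section \<open>Coercivity and variation on balls\<close>

text \<open>The identity <X^T X, Y Y^T> = |X Y|^2 makes the quartic cross terms of f and c cancel.
  What remains, up to a constant, is a quarter of |X^T X|^2 + |Y Y^T|^2, of order |z|^4, against the
  quadratic term <X Y, M>.\<close>

lemma coercive_mf_f_plus_mf_c:
  fixes M :: "real^'n^'m"
  shows "coercive (\<lambda>z :: (real^'r^'m) \<times> (real^'n^'r). mf_f M z + mf_c z)"
  unfolding coercive_def filterlim_at_top eventually_at_infinity
proof
  fix B :: real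
  \<comment> \<open>Since |A|^2 = <I, A^T A>, a bound on the norm of the identity compares |A|^2
    with |A^T A|; the added 1 makes positivity evident.\<close>
  define \<kappa> where "\<kappa> = 1 + norm (mat 1 :: real^'r^'r)"
  have "\<kappa> > 0" by (simp add: \<kappa>_def add_pos_nonneg)
  \<comment> \<open>Beyond \<open>N\<close> the bracket |z|^2 / (8 \<kappa>^2) - |M| / 2 is at least
    |B|. The 8 is 4 from the quarter times 2 from (p + q)^2 \<le> 2 (p^2 + q^2).\<close>
  define N where "N = max 1 (8 * \<kappa>\<^sup>2 * (\<bar>B\<bar> + norm M / 2))"
  have gram: "(norm A)\<^sup>2 \<le> \<kappa> * norm (transpose A ** A)" for A :: "real^'r^'x"
  proof -
    have "(norm A)\<^sup>2 = (A ** mat 1) \<bullet> A" by (simp add: power2_norm_eq_inner)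
    also have "\<dots> = mat 1 \<bullet> (transpose A ** A)" by (rule inner_matrix_mul_left)
    also have "\<dots> \<le> norm (mat 1 :: real^'r^'r) * norm (transpose A ** A)" by (rule norm_cauchy_schwarz)
    also have "\<dots> \<le> \<kappa> * norm (transpose A ** A)" by (intro mult_right_mono) (auto simp: \<kappa>_def)
    finally show ?thesis .
  qed
  have sq_diff: "(V - W) \<bullet> (V - W) = V \<bullet> V - 2 * (V \<bullet> W) + W \<bullet> W" for V W :: "real^'x^'y"
    by (simp add: inner_diff inner_commute)
  have "B \<le> mf_f M z + mf_c z" if "N \<le> norm z" for z :: "(real^'r^'m) \<times> (real^'n^'r)"
  proof -
    obtain X Y where z: "z = (X, Y)" by (cases z)
    let ?G = "transpose X ** X" and ?H = "Y ** transpose Y"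
    have GH: "?G \<bullet> ?H = (X ** Y) \<bullet> (X ** Y)"
      by (simp add: inner_matrix_mul_left[of "transpose X"] inner_matrix_mul_right[of X Y] matrix_mul_assoc)
    have "mf_f M z + mf_c z = ((norm ?G)\<^sup>2 + (norm ?H)\<^sup>2) / 4 - (X ** Y) \<bullet> M + (norm M)\<^sup>2 / 2"
    proof -
      have "mf_f M z = ((X ** Y) \<bullet> (X ** Y)) / 2 - (X ** Y) \<bullet> M + (norm M)\<^sup>2 / 2"
        using sq_diff[of "X ** Y" M] by (simp add: z mf_f_inner power2_norm_eq_inner field_simps)
      moreover have "mf_c z = ((norm ?G)\<^sup>2 + (norm ?H)\<^sup>2) / 4 - (?G \<bullet> ?H) / 2"
        using sq_diff[of ?G ?H] by (simp add: z mf_c_imbalance imbalance_def power2_norm_eq_inner field_simps)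
      ultimately show ?thesis unfolding GH by simp
    qed
    moreover have "(X ** Y) \<bullet> M \<le> norm M * (norm z)\<^sup>2 / 2"
    proof -
      have "(X ** Y) \<bullet> M \<le> norm (X ** Y) * norm M" by (rule norm_cauchy_schwarz)
      also have "\<dots> \<le> (norm X * norm Y) * norm M" by (intro mult_right_mono norm_matrix_mul) simp
      also have "\<dots> \<le> ((norm X)\<^sup>2 + (norm Y)\<^sup>2) / 2 * norm M"
        using sum_squares_bound[of "norm X" "norm Y"] by (intro mult_right_mono) auto
      also have "\<dots> = norm M * (norm z)\<^sup>2 / 2" by (simp add: z norm_Pair)
      finally show ?thesis .
    qed
    moreover have "(norm z) ^ 4 / (2 * \<kappa>\<^sup>2) \<le> (norm ?G)\<^sup>2 + (norm ?H)\<^sup>2"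
    proof -
      have "((norm X)\<^sup>2)\<^sup>2 \<le> (\<kappa> * norm ?G)\<^sup>2" by (intro power_mono gram) simp
      moreover have "((norm Y)\<^sup>2)\<^sup>2 \<le> (\<kappa> * norm ?H)\<^sup>2" using gram[of "transpose Y"] by (intro power_mono) auto
      moreover have "((norm X)\<^sup>2 + (norm Y)\<^sup>2)\<^sup>2 \<le> 2 * (((norm X)\<^sup>2)\<^sup>2 + ((norm Y)\<^sup>2)\<^sup>2)"
        using zero_le_power2[of "(norm X)\<^sup>2 - (norm Y)\<^sup>2"] unfolding power2_sum power2_diff by argo
      moreover have "(norm z) ^ 4 = ((norm X)\<^sup>2 + (norm Y)\<^sup>2)\<^sup>2"
      proof -
        have "(norm z) ^ 4 = ((norm z)\<^sup>2)\<^sup>2" by (simp flip: power_mult)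
        then show ?thesis by (simp add: z norm_Pair)
      qed
      ultimately have "(norm z) ^ 4 \<le> 2 * \<kappa>\<^sup>2 * ((norm ?G)\<^sup>2 + (norm ?H)\<^sup>2)"
        by (simp add: power_mult_distrib algebra_simps)
      then show ?thesis using \<open>\<kappa> > 0\<close> by (simp add: pos_divide_le_eq mult.commute)
    qed
    moreover have "(norm z)\<^sup>2 * ((norm z)\<^sup>2 / (8 * \<kappa>\<^sup>2) - norm M / 2)
        = (norm z) ^ 4 / (2 * \<kappa>\<^sup>2) / 4 - norm M * (norm z)\<^sup>2 / 2"
      by (simp add: right_diff_distrib power4_eq_xxxx power2_eq_square mult_ac)
    moreover have "(norm M)\<^sup>2 / 2 \<ge> 0" by simp
    \<comment> \<open>The facts gathered so far combine linearly; stated over plain reals, the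
      combination is independent of the shape of the matrix terms.\<close>
    moreover have "lhs \<le> t" if "t = (a + b) / 4 - i + q" "i \<le> u" "e \<le> a + b" "lhs = e / 4 - u" "0 \<le> q"
      for lhs t a b i q u e :: real
    proof -
      have "e / 4 \<le> (a + b) / 4" using that(3) by simp
      then show ?thesis using that(1,2,4,5) by linarith
    qed
    ultimately have 1: "(norm z)\<^sup>2 * ((norm z)\<^sup>2 / (8 * \<kappa>\<^sup>2) - norm M / 2) \<le> mf_f M z + mf_c z"
      by blast
    have nz: "1 \<le> norm z" "8 * \<kappa>\<^sup>2 * (\<bar>B\<bar> + norm M / 2) \<le> norm z" using that by (auto simp: N_def)
    then have sq: "norm z \<le> (norm z)\<^sup>2" by (simp add: self_le_power)
    then have "8 * \<kappa>\<^sup>2 * (\<bar>B\<bar> + norm M / 2) \<le> (norm z)\<^sup>2" using nz by linarith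
    then have "\<bar>B\<bar> \<le> (norm z)\<^sup>2 / (8 * \<kappa>\<^sup>2) - norm M / 2"
      using \<open>\<kappa> > 0\<close> by (simp add: field_simps)
    moreover have "1 \<le> (norm z)\<^sup>2" using sq nz by linarith
    ultimately have "1 * \<bar>B\<bar> \<le> (norm z)\<^sup>2 * ((norm z)\<^sup>2 / (8 * \<kappa>\<^sup>2) - norm M / 2)"
      by (intro mult_mono) auto
    then show ?thesis using 1 by linarith
  qed
  then show "\<exists>b. \<forall>z :: (real^'r^'m) \<times> (real^'n^'r). b \<le> norm z \<longrightarrow> B \<le> mf_f M z + mf_c z" by blast
qed

section \<open>Variation of f on balls\<close>

lemma norm_mul_le_half_sq:
  fixes H :: "real^'r^'m" and K :: "real^'n^'r"
  shows "norm (H ** K) \<le> (norm (H, K))\<^sup>2 / 2"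
proof -
  have "norm (H ** K) \<le> norm H * norm K" by (rule norm_matrix_mul)
  also have "\<dots> \<le> (norm (H, K))\<^sup>2 / 2"
    using sum_squares_bound[of "norm H" "norm K"] by (simp add: norm_Pair)
  finally show ?thesis .
qed

lemma norm_perturbation_le:
  fixes X :: "real^'r^'m" and Y :: "real^'n^'r"
  assumes "norm (H, K) \<le> \<rho>"
  shows "norm (H ** Y + X ** K + H ** K) \<le> sqrt (spectral_sq (X, Y)) * \<rho> + \<rho>\<^sup>2 / 2"
proof -
  have "norm (H ** Y + X ** K + H ** K) \<le> sqrt (spectral_sq (X, Y)) * norm (H, K) + (norm (H, K))\<^sup>2 / 2"
    by (intro norm_triangle_le add_mono norm_mul_add_mul_le norm_mul_le_half_sq)
  also have "\<dots> \<le> sqrt (spectral_sq (X, Y)) * \<rho> + \<rho>\<^sup>2 / 2"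
    using assms by (intro add_mono mult_left_mono divide_right_mono power_mono) (auto simp: spectral_sq_def)
  finally show ?thesis .
qed

lemma mf_f_perturbation:
  assumes "X ** Y = M"
  shows "mf_f M (X + H, Y + K) = (norm (H ** Y + X ** K + H ** K))\<^sup>2 / 2"
proof -
  have "(X + H) ** (Y + K) - M = H ** Y + X ** K + H ** K"
    using assms by (simp add: mul.add_left mul.add_right)
  then show ?thesis by (simp add: mf_f_def)
qed

lemma mf_f_nonneg: "0 \<le> mf_f M z"
  by (simp add: mf_f_inner)

lemma mf_f_eq_0: "X ** Y = M \<Longrightarrow> mf_f M (X, Y) = 0"
  by (simp add: mf_f_def)

lemma mf_f_ball_le:
  fixes X :: "real^'r^'m" and Y :: "real^'n^'r"
  assumes M: "X ** Y = M" and w: "w \<in> cball (X, Y) \<rho>"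
  shows "\<bar>mf_f M w - mf_f M (X, Y)\<bar> \<le> (sqrt (spectral_sq (X, Y)) * \<rho> + \<rho>\<^sup>2 / 2)\<^sup>2 / 2"
proof -
  define H K where "H = fst w - X" and "K = snd w - Y"
  have w': "w = (X + H, Y + K)" by (simp add: H_def K_def)
  have "norm (H, K) \<le> \<rho>"
    using w unfolding w' by (simp add: dist_norm norm_Pair)
  then have "(norm (H ** Y + X ** K + H ** K))\<^sup>2 \<le> (sqrt (spectral_sq (X, Y)) * \<rho> + \<rho>\<^sup>2 / 2)\<^sup>2"
    by (intro power_mono norm_perturbation_le) auto
  then show ?thesis by (simp add: w' mf_f_perturbation[OF M] mf_f_eq_0[OF M])
qed

lemma ball_variation_mf_f_le:
  fixes X :: "real^'r^'m" and Y :: "real^'n^'r"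
  assumes "X ** Y = M" "\<rho> > 0"
  shows "ball_variation (mf_f M) (X, Y) \<rho> \<le> (sqrt (spectral_sq (X, Y)) * \<rho> + \<rho>\<^sup>2 / 2)\<^sup>2 / 2"
  unfolding ball_variation_def using assms mf_f_ball_le[OF assms(1)] by (intro cSUP_least) auto

lemma ball_variation_mf_f_ge:
  fixes X :: "real^'r^'m" and Y :: "real^'n^'r"
  assumes M: "X ** Y = M" and HK: "norm (H, K) \<le> \<rho>"
    and \<gamma>: "0 \<le> \<gamma>" "\<gamma> \<le> norm (H ** Y + X ** K + H ** K)"
  shows "\<gamma>\<^sup>2 / 2 \<le> ball_variation (mf_f M) (X, Y) \<rho>"
proof -
  have "\<gamma>\<^sup>2 / 2 \<le> \<bar>mf_f M (X + H, Y + K) - mf_f M (X, Y)\<bar>"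
    using power_mono[OF \<gamma>(2,1), of 2] by (simp add: mf_f_perturbation[OF M] mf_f_eq_0[OF M])
  also have "\<dots> \<le> ball_variation (mf_f M) (X, Y) \<rho>"
    unfolding ball_variation_def
  proof (rule cSUP_upper)
    show "(X + H, Y + K) \<in> cball (X, Y) \<rho>" using HK by (simp add: dist_norm norm_Pair)
    show "bdd_above ((\<lambda>y. \<bar>mf_f M y - mf_f M (X, Y)\<bar>) ` cball (X, Y) \<rho>)"
      using mf_f_ball_le[OF M] by (intro bdd_aboveI2)
  qed
  finally show ?thesis .
qed

text \<open>Let l be the square root of \<open>spectral_sq (X, Y)\<close>. A step of length \<rho>
  along the top eigenvector gains l \<rho> to first order, and the product H K can undo at most
  \<rho>^2 / 2. The bound \<rho> / 2 \<le> l keeps the difference nonnegative, so it may be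
  squared.\<close>

lemma ball_variation_mf_f_ge_eigenvector:
  fixes X :: "real^'r^'m" and Y :: "real^'n^'r"
  assumes M: "X ** Y = M" and pos: "spectral_sq (X, Y) > 0"
    and \<rho>: "0 < \<rho>" "\<rho> / 2 \<le> sqrt (spectral_sq (X, Y))"
  shows "(sqrt (spectral_sq (X, Y)) * \<rho> - \<rho>\<^sup>2 / 2)\<^sup>2 / 2 \<le> ball_variation (mf_f M) (X, Y) \<rho>"
proof -
  let ?a = "spectral_norm X" and ?b = "spectral_norm Y"
  define l where "l = sqrt (spectral_sq (X, Y))"
  have "l > 0" using pos by (simp add: l_def)
  have l2: "?a\<^sup>2 + ?b\<^sup>2 = l\<^sup>2" using pos by (simp add: l_def) (simp add: spectral_sq_def)
  obtain p v q w where n: "norm p = 1" "norm v = 1" "norm q = 1" "norm w = 1"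
    and s: "X *v p = ?a *\<^sub>R v" "transpose X *v v = ?a *\<^sub>R p"
      "Y *v w = ?b *\<^sub>R q" "transpose Y *v q = ?b *\<^sub>R w" by (rule singular_triples)
  define H where "H = (\<rho> / l * ?b) *\<^sub>R outer v q"
  define K where "K = (\<rho> / l * ?a) *\<^sub>R outer p w"
  have "(norm (H, K))\<^sup>2 = (\<rho> / l)\<^sup>2 * (?a\<^sup>2 + ?b\<^sup>2)"
    by (simp add: H_def K_def norm_Pair norm_outer n power_mult_distrib power_divide algebra_simps)
  also have "\<dots> = \<rho>\<^sup>2" unfolding l2 using \<open>l > 0\<close> by (simp add: power_divide)
  finally have nHK: "norm (H, K) = \<rho>" using \<rho> by (metis norm_ge_zero less_imp_le power2_eq_iff_nonneg)
  have "H ** Y = (\<rho> / l * ?b * ?b) *\<^sub>R outer v w" "X ** K = (\<rho> / l * ?a * ?a) *\<^sub>R outer v w"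
    by (simp_all add: H_def K_def mul.scaleR_left mul.scaleR_right outer_matrix_mul matrix_mul_outer s
        outer_scaleR_left outer_scaleR_right)
  then have "H ** Y + X ** K = (\<rho> / l * (?a\<^sup>2 + ?b\<^sup>2)) *\<^sub>R outer v w"
    by (simp add: power2_eq_square distrib_left mult.assoc scaleR_add_left)
  then have "norm (H ** Y + X ** K) = l * \<rho>"
    unfolding l2 using \<open>l > 0\<close> \<rho> by (simp add: norm_outer n power2_eq_square)
  moreover have "norm (H ** K) \<le> \<rho>\<^sup>2 / 2" using norm_mul_le_half_sq[of H K] nHK by simp
  ultimately have "l * \<rho> - \<rho>\<^sup>2 / 2 \<le> norm (H ** Y + X ** K + H ** K)"
    using norm_diff_ineq[of "H ** Y + X ** K" "H ** K"] by linarith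
  moreover have "0 \<le> l * \<rho> - \<rho>\<^sup>2 / 2"
    using mult_right_mono[OF \<rho>(2), of \<rho>] \<rho>(1) by (simp add: l_def power2_eq_square)
  ultimately show ?thesis
    using ball_variation_mf_f_ge[OF M eq_refl[OF nHK]] by (simp add: l_def)
qed

text \<open>When \<open>mf_phi\<close> vanishes, \<open>X\<close> and \<open>Y\<close> have equal norms and share a top singular vector \<open>p\<close>, so the
  upper bound for the variation is attained by \<open>(h v p\<^sup>T, h p w\<^sup>T)\<close>, including its quadratic part.\<close>

lemma ball_variation_mf_f_eq:
  fixes X :: "real^'r^'m" and Y :: "real^'n^'r"
  assumes M: "X ** Y = M" and \<phi>: "mf_phi (X, Y) = 0" and "\<rho> > 0"
  shows "ball_variation (mf_f M) (X, Y) \<rho> = (sqrt (spectral_sq (X, Y)) * \<rho> + \<rho>\<^sup>2 / 2)\<^sup>2 / 2"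
proof (rule antisym)
  let ?a = "spectral_norm X" and ?b = "spectral_norm Y"
  have 1: "(?a - ?b)\<^sup>2 + 2 * (?a * ?b - spectral_norm (X ** Y)) = 0"
    using \<phi> by (simp add: mf_phi_spectral_sq spectral_sq_def power2_eq_square algebra_simps)
  have 2: "?a * ?b - spectral_norm (X ** Y) \<ge> 0" using spectral_norm_mul_le[of X Y] by simp
  have "y = 0 \<and> x = 0" if "x + 2 * y = 0" "y \<ge> 0" "x \<ge> 0" for x y :: real using that by linarith
  from this[OF 1 2 zero_le_power2]
  have "(?a - ?b)\<^sup>2 = 0" and p': "spectral_norm (X ** Y) = ?a * ?b" by auto
  then have ab: "?b = ?a" by simp
  \<comment> \<open>A top singular vector of X Y loses nothing in either factor: |X Y w| = a b
    forces |Y w| = b, and then X attains its norm at the direction p of Y w.\<close>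
  obtain w where w: "norm w = 1" "norm ((X ** Y) *v w) = spectral_norm (X ** Y)" by (rule spectral_norm_attained)
  have XYw: "norm (X *v (Y *v w)) = ?a * ?a" using w(2) p' by (simp add: ab matrix_vector_mul_assoc)
  have Yw: "norm (Y *v w) = ?b"
  proof (rule antisym)
    show "norm (Y *v w) \<le> ?b" using norm_matrix_vector[of Y w] w by simp
    have "?a * ?a \<le> ?a * norm (Y *v w)" using norm_matrix_vector[of X "Y *v w"] XYw by simp
    then show "?b \<le> norm (Y *v w)" using spectral_norm_nonneg[of X] ab by (cases "?a = 0") auto
  qed
  obtain p where p: "norm p = 1" "Y *v w = ?b *\<^sub>R p" "transpose Y *v p = ?b *\<^sub>R w"
    using singular_pair[OF w(1) Yw] by blast
  have Xp: "norm (X *v p) = ?a"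
  proof (cases "?a = 0")
    case True
    then show ?thesis using norm_matrix_vector[of X p] by simp
  next
    case False
    then show ?thesis using XYw spectral_norm_nonneg[of X] by (simp add: p ab matrix_vector_mult_scaleR)
  qed
  obtain v where v: "norm v = 1" "X *v p = ?a *\<^sub>R v" using singular_pair[OF p(1) Xp] by blast
  \<comment> \<open>Splits the radius equally between the two components: 2 h^2 = \<rho>^2.\<close>
  define h where "h = sqrt 2 * \<rho> / 2"
  have h: "h > 0" "h * h = \<rho>\<^sup>2 / 2" "h * 2 = sqrt 2 * \<rho>"
    using \<open>\<rho> > 0\<close> by (simp_all add: h_def power2_eq_square)
  let ?H = "h *\<^sub>R outer v p" and ?K = "h *\<^sub>R outer p w"
  have "(norm (?H, ?K))\<^sup>2 = \<rho>\<^sup>2"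
    using h by (simp add: norm_Pair norm_outer p w v power2_eq_square)
  then have nHK: "norm (?H, ?K) = \<rho>" using \<open>\<rho> > 0\<close> by (metis norm_ge_zero less_imp_le power2_eq_iff_nonneg)
  have "?H ** Y = (h * ?a) *\<^sub>R outer v w" "X ** ?K = (h * ?a) *\<^sub>R outer v w" "?H ** ?K = (h * h) *\<^sub>R outer v w"
    using p v by (simp_all add: mul.scaleR_left mul.scaleR_right outer_matrix_mul matrix_mul_outer
        outer_vector outer_scaleR_left outer_scaleR_right ab norm_eq_1 flip: scaleR_matrix_vector_assoc)
  then have "?H ** Y + X ** ?K + ?H ** ?K = (h * ?a + h * ?a + h * h) *\<^sub>R outer v w"
    by (simp only: scaleR_add_left)
  moreover have "h * ?a + h * ?a + h * h = sqrt (spectral_sq (X, Y)) * \<rho> + \<rho>\<^sup>2 / 2"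
  proof -
    have "sqrt (spectral_sq (X, Y)) = sqrt 2 * ?a"
      by (simp add: spectral_sq_def ab real_sqrt_mult spectral_norm_nonneg flip: mult_2)
    moreover have "h * ?a + h * ?a + h * h = (h * 2) * ?a + h * h" by (simp add: algebra_simps)
    ultimately show ?thesis unfolding h(2,3) by simp
  qed
  ultimately show "(sqrt (spectral_sq (X, Y)) * \<rho> + \<rho>\<^sup>2 / 2)\<^sup>2 / 2 \<le> ball_variation (mf_f M) (X, Y) \<rho>"
    using \<open>\<rho> > 0\<close> by (intro ball_variation_mf_f_ge[OF M eq_refl[OF nHK]]) (auto simp: norm_outer v w spectral_sq_def)
  show "ball_variation (mf_f M) (X, Y) \<rho> \<le> (sqrt (spectral_sq (X, Y)) * \<rho> + \<rho>\<^sup>2 / 2)\<^sup>2 / 2"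
    by (rule ball_variation_mf_f_le[OF M \<open>\<rho> > 0\<close>])
qed

text \<open>With a strict gap l' < l of the square roots, the worst-case errors \<rho>^2 / 2 on both
  sides fit into it once \<rho> \<le> l - l'. If \<open>mf_phi\<close> vanishes at both points, both
  values of \<open>spectral_sq\<close> are 2 |M|_2 and the exact formula gives equality at every
  radius.\<close>

lemma flatter_eq_mf_f:
  fixes z z' :: "(real^'r^'m) \<times> (real^'n^'r)"
  assumes M: "fst z ** snd z = M" "fst z' ** snd z' = M"
    and lt: "spectral_sq z' < spectral_sq z \<or> mf_phi z = 0 \<and> mf_phi z' = 0"
  shows "flatter_eq (mf_f M) z' z"
proof -
  obtain X Y X' Y' where z: "z = (X, Y)" "z' = (X', Y')" by (cases z, cases z')
  have M': "X ** Y = M" "X' ** Y' = M" using M by (simp_all add: z)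
  show ?thesis using lt
  proof
    assume "mf_phi z = 0 \<and> mf_phi z' = 0"
    then have "mf_phi (X, Y) = 0" "mf_phi (X', Y') = 0" "spectral_sq (X, Y) = spectral_sq (X', Y')"
      using M by (auto simp: z mf_phi_spectral_sq)
    then show ?thesis
      unfolding flatter_eq_def z
      by (intro exI[of _ 1]) (simp add: ball_variation_mf_f_eq[OF M'(1)] ball_variation_mf_f_eq[OF M'(2)])
  next
    assume less: "spectral_sq z' < spectral_sq z"
    let ?l = "sqrt (spectral_sq (X, Y))" and ?l' = "sqrt (spectral_sq (X', Y'))"
    have nn: "0 \<le> spectral_sq z'" by (simp add: spectral_sq_def)
    then have pos: "spectral_sq (X, Y) > 0" using less by (simp add: z)
    have gap: "0 < ?l - ?l'" "0 \<le> ?l'" using less nn by (auto simp: z)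
    show ?thesis
      unfolding flatter_eq_def z
    proof (intro exI[of _ "?l - ?l'"] conjI ballI gap(1))
      fix \<rho> assume "\<rho> \<in> {0<..?l - ?l'}"
      then have \<rho>: "0 < \<rho>" "\<rho> \<le> ?l - ?l'" by auto
      have "ball_variation (mf_f M) (X', Y') \<rho> \<le> (?l' * \<rho> + \<rho>\<^sup>2 / 2)\<^sup>2 / 2"
        by (rule ball_variation_mf_f_le[OF M'(2) \<rho>(1)])
      also have "\<dots> \<le> (?l * \<rho> - \<rho>\<^sup>2 / 2)\<^sup>2 / 2"
      proof -
        have "\<rho> * \<rho> \<le> (?l - ?l') * \<rho>" using \<rho> by (intro mult_right_mono) auto
        then have "?l' * \<rho> + \<rho>\<^sup>2 / 2 \<le> ?l * \<rho> - \<rho>\<^sup>2 / 2" by (simp add: power2_eq_square algebra_simps)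
        then show ?thesis using \<rho> gap by (intro divide_right_mono power_mono) auto
      qed
      also have "\<dots> \<le> ball_variation (mf_f M) (X, Y) \<rho>"
        by (rule ball_variation_mf_f_ge_eigenvector[OF M'(1) pos \<rho>(1)]) (use \<rho> gap in linarith)
      finally show "ball_variation (mf_f M) (X', Y') \<rho> \<le> ball_variation (mf_f M) (X, Y) \<rho>" .
    qed
  qed
qed

section \<open>The flow\<close>

text \<open>With velocity (- X D, D Y) the product rule gives X (D Y) - (X D) Y = 0.\<close>

lemma flow_product_constant:
  assumes sol: "global_solution (\<lambda>z. - c_grad z) z0 x" and "t \<ge> 0"
  shows "fst (x t) ** snd (x t) = fst z0 ** snd z0"
proof -
  have "((\<lambda>t. fst (x t) ** snd (x t)) has_vector_derivative 0) (at s within {0..})" if "s \<in> {0..}" for s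
  proof -
    have x: "(x has_vector_derivative - c_grad (x s)) (at s within {0..})"
      using sol that by (simp add: global_solution_def)
    have "((\<lambda>t. fst (x t) ** snd (x t)) has_vector_derivative
      fst (x s) ** snd (- c_grad (x s)) + fst (- c_grad (x s)) ** snd (x s)) (at s within {0..})"
      by (intro bounded_bilinear.has_vector_derivative[OF bounded_bilinear_matrix_mul]
          bounded_linear.has_vector_derivative[OF bounded_linear_fst x]
          bounded_linear.has_vector_derivative[OF bounded_linear_snd x])
    then show ?thesis by (simp add: c_grad_def mul.minus_left matrix_mul_assoc)
  qed
  then obtain k where "\<And>s. s \<in> {0..} \<Longrightarrow> fst (x s) ** snd (x s) = k"
    by (rule has_vector_derivative_zero_constant[rotated]) auto
  then have "fst (x t) ** snd (x t) = fst (x 0) ** snd (x 0)" using \<open>t \<ge> 0\<close> by simp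
  then show ?thesis using sol by (simp add: global_solution_def)
qed

lemma inner_c_grad_nonneg: "0 \<le> z \<bullet> c_grad z"
  by (simp add: inner_c_grad)

lemma lipschitz_on_minus_c_grad: "\<exists>L. L-lipschitz_on (cball 0 R) (\<lambda>z. - c_grad z)"
  using lipschitz_on_c_grad[OF bounded_cball, of 0 R] lipschitz_on_minus by blast

lemma flow_exists:
  fixes z0 :: "(real^'r^'m) \<times> (real^'n^'r)"
  obtains x where "global_solution (\<lambda>z. - c_grad z) z0 x"
  \<comment> \<open>The 3 is the degree of homogeneity of the field.\<close>
  by (rule global_solution_exists_dissipative[of "\<lambda>z. - c_grad z" 3 z0, OF lipschitz_on_minus_c_grad])
    (auto simp: c_grad_scaleR inner_c_grad_nonneg)

text \<open>Both solutions stay in the ball of radius \<open>norm z0\<close>, where the cubic field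
  is Lipschitz.\<close>

lemma flow_unique:
  fixes x y :: "real \<Rightarrow> (real^'r^'m) \<times> (real^'n^'r)"
  assumes x: "global_solution (\<lambda>z. - c_grad z) z0 x" and y: "global_solution (\<lambda>z. - c_grad z) z0 y" and "t \<ge> 0"
  shows "y t = x t"
proof -
  have ball: "w s \<in> cball 0 (norm z0)" if "global_solution (\<lambda>z. - c_grad z) z0 w" "s \<ge> 0"
    for w :: "real \<Rightarrow> (real^'r^'m) \<times> (real^'n^'r)" and s
    using global_solution_norm_le[OF that(1) _ order_refl that(2)] that(1)
    by (simp add: inner_c_grad_nonneg global_solution_def)
  obtain L where "L-lipschitz_on (cball 0 (norm z0)) (\<lambda>z :: (real^'r^'m) \<times> (real^'n^'r). - c_grad z)"
    using lipschitz_on_minus_c_grad by blast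
  from global_solution_unique[OF x y this ball[OF x] ball[OF y] \<open>t \<ge> 0\<close>] show ?thesis .
qed

lemma lipschitz_on_ball_spectral_sq: "\<exists>L. L-lipschitz_on (ball z 1) spectral_sq"
proof -
  have "ball z 1 \<subseteq> cball 0 (norm z + 1)"
  proof
    fix w assume "w \<in> ball z 1"
    then show "w \<in> cball 0 (norm z + 1)"
      using norm_triangle_sub[of w z] by (simp add: dist_norm norm_minus_commute)
  qed
  moreover have "(4 * (norm z + 1))-lipschitz_on (cball 0 (norm z + 1)) spectral_sq"
    by (rule lipschitz_on_spectral_sq) simp
  ultimately show ?thesis using lipschitz_on_subset by blast
qed

lemma flow_spectral_sq_right:
  assumes sol: "global_solution (\<lambda>z. - c_grad z) z0 x" and "t \<ge> 0"
  obtains d where "((\<lambda>t. spectral_sq (x t)) has_real_derivative d) (at_right t)" "d \<le> - (mf_phi (x t))\<^sup>2"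
proof -
  obtain d where d: "has_dir_deriv spectral_sq (x t) (- c_grad (x t)) d" "d \<le> - (mf_phi (x t))\<^sup>2"
    by (rule spectral_sq_dir_deriv_c_grad)
  obtain L where "L-lipschitz_on (ball (x t) 1) spectral_sq" using lipschitz_on_ball_spectral_sq by blast
  from dir_deriv_along_curve[OF this _ d(1) global_solution_right[OF sol \<open>t \<ge> 0\<close>]] d(2) that
  show thesis by simp
qed

text \<open>Only existence is claimed: where the left and right derivatives agree, the bound is
  inherited from the right.\<close>

lemma flow_spectral_sq_left:
  assumes sol: "global_solution (\<lambda>z. - c_grad z) z0 x" and "t > 0"
  shows "\<exists>d. ((\<lambda>t. spectral_sq (x t)) has_real_derivative d) (at_left t)"
proof -
  obtain d where d: "has_dir_deriv spectral_sq (x t) (- (- c_grad (x t))) d"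
    using convex_has_dir_deriv[OF convex_on_spectral_sq] by blast
  obtain L where L: "L-lipschitz_on (ball (x t) 1) spectral_sq" using lipschitz_on_ball_spectral_sq by blast
  have "(x has_vector_derivative - c_grad (x t)) (at_left t)"
    by (rule has_vector_derivative_at_within[OF global_solution_at[OF sol \<open>t > 0\<close>]])
  from dir_deriv_along_curve_left[OF L _ d this] show ?thesis by auto
qed

lemma flow_mf_phi:
  assumes sol: "global_solution (\<lambda>z. - c_grad z) z0 x" and "t \<ge> 0"
  shows "mf_phi (x t) = spectral_sq (x t) - 2 * spectral_norm (fst z0 ** snd z0)"
  using flow_product_constant[OF assms] by (simp add: mf_phi_spectral_sq)

text \<open>Phrased through \<open>spectral_sq\<close>, since this expression equals
  \<open>mf_phi\<close> along the flow for nonnegative times and the subtracted constant leaves the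
  derivative unchanged.\<close>

lemma flow_mf_phi_right:
  assumes sol: "global_solution (\<lambda>z. - c_grad z) z0 x" and "t \<ge> 0"
  obtains d where "((\<lambda>t. spectral_sq (x t) - 2 * spectral_norm (fst z0 ** snd z0)) has_real_derivative d) (at_right t)"
    "d \<le> - (mf_phi (x t))\<^sup>2"
proof -
  obtain d where "((\<lambda>t. spectral_sq (x t)) has_real_derivative d) (at_right t)" "d \<le> - (mf_phi (x t))\<^sup>2"
    using flow_spectral_sq_right[OF assms] .
  then show thesis using that[of d] DERIV_diff[OF _ DERIV_const] by fastforce
qed

lemma flow_continuous_spectral_sq:
  assumes sol: "global_solution (\<lambda>z. - c_grad z) z0 x" and "s \<ge> 0"
  shows "continuous_on {s..t} (\<lambda>t. spectral_sq (x t))"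
proof (rule continuous_on_compose2[of UNIV spectral_sq])
  show "continuous_on UNIV spectral_sq" by (rule convex_on_continuous[OF open_UNIV convex_on_spectral_sq])
  show "continuous_on {s..t} x"
    by (rule continuous_on_subset[OF global_solution_continuous[OF sol]]) (use \<open>s \<ge> 0\<close> in auto)
qed simp

lemma flow_mf_phi_decreasing:
  assumes sol: "global_solution (\<lambda>z. - c_grad z) z0 x" and st: "0 \<le> s" "s \<le> t"
  shows "mf_phi (x t) \<le> mf_phi (x s)"
proof -
  let ?g = "\<lambda>t. spectral_sq (x t) - 2 * spectral_norm (fst z0 ** snd z0)"
  have "?g t \<le> ?g s"
  proof (rule right_derivative_nonpos_imp_le[OF st(2)])
    show "continuous_on {s..t} ?g" by (intro continuous_intros flow_continuous_spectral_sq[OF sol st(1)])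
    fix r assume "s \<le> r" "r < t"
    then obtain d where "(?g has_real_derivative d) (at_right r)" "d \<le> - (mf_phi (x r))\<^sup>2"
      using flow_mf_phi_right[OF sol, of r] st by auto
    then show "\<exists>d\<le>0. (?g has_real_derivative d) (at_right r)"
      using zero_le_power2[of "mf_phi (x r)"] by (intro exI[of _ d]) linarith
  qed
  then show ?thesis using st by (simp add: flow_mf_phi[OF sol])
qed

text \<open>The Riccati inequality \<open>\<phi>' \<le> - \<phi>\<^sup>2\<close> says that \<open>1 / \<phi>\<close> grows at least at unit speed.\<close>

lemma flow_mf_phi_riccati:
  assumes sol: "global_solution (\<lambda>z. - c_grad z) z0 x" and st: "0 \<le> s" "s \<le> t" and pos: "mf_phi (x t) > 0"
  shows "1 / mf_phi (x s) + (t - s) \<le> 1 / mf_phi (x t)"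
proof -
  let ?g = "\<lambda>t. spectral_sq (x t) - 2 * spectral_norm (fst z0 ** snd z0)"
  have g: "?g r = mf_phi (x r)" if "s \<le> r" for r using that st by (simp add: flow_mf_phi[OF sol])
  \<comment> \<open>Monotonicity carries positivity at the final time back to the whole interval, so
    the reciprocal behaves there.\<close>
  have gpos: "?g r > 0" if "s \<le> r" "r \<le> t" for r
    using flow_mf_phi_decreasing[OF sol, of r t] that st pos g[of r] by simp
  have "t - inverse (?g t) \<le> s - inverse (?g s)"
  proof (rule right_derivative_nonpos_imp_le[OF st(2)])
    show "continuous_on {s..t} (\<lambda>r. r - inverse (?g r))"
      by (intro continuous_intros flow_continuous_spectral_sq[OF sol st(1)] ballI) (use gpos in force)
    fix r assume r: "s \<le> r" "r < t"
    then obtain d where d: "(?g has_real_derivative d) (at_right r)" "d \<le> - (mf_phi (x r))\<^sup>2"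
      using flow_mf_phi_right[OF sol, of r] st by auto
    have nz: "?g r > 0" using gpos r by simp
    have "((\<lambda>r. r - inverse (?g r)) has_real_derivative 1 - (- (inverse (?g r) * d * inverse (?g r)))) (at_right r)"
      by (rule DERIV_diff[OF DERIV_ident DERIV_inverse'[OF d(1)]]) (use nz in simp)
    moreover have "1 - (- (inverse (?g r) * d * inverse (?g r))) \<le> 0"
    proof -
      have "d / (?g r)\<^sup>2 \<le> - 1" using d(2) nz g[of r] r by (simp add: pos_divide_le_eq)
      then show ?thesis by (simp add: field_simps power2_eq_square)
    qed
    ultimately show "\<exists>d\<le>0. ((\<lambda>r. r - inverse (?g r)) has_real_derivative d) (at_right r)" by blast
  qed
  then show ?thesis using g[of s] g[of t] st by (simp add: inverse_eq_divide)
qed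

text \<open>The Riccati estimate from time 0, with the nonnegative term
  \<open>1 / mf_phi (x 0)\<close> dropped.\<close>

lemma flow_mf_phi_le:
  assumes sol: "global_solution (\<lambda>z. - c_grad z) z0 x" and "t > 0"
  shows "mf_phi (x t) \<le> 1 / t"
proof (cases "mf_phi (x t) > 0")
  case True
  have "1 / mf_phi (x 0) \<ge> 0" using mf_phi_nonneg by simp
  then have "t \<le> 1 / mf_phi (x t)"
    using flow_mf_phi_riccati[OF sol order_refl _ True] \<open>t > 0\<close> by linarith
  then show ?thesis using True \<open>t > 0\<close> by (simp add: field_simps)
next
  case False
  then show ?thesis using \<open>t > 0\<close> by (smt (verit) divide_pos_pos)
qed

lemma flow_flattening:
  fixes x :: "real \<Rightarrow> (real^'r^'m) \<times> (real^'n^'r)"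
  assumes sol: "global_solution (\<lambda>z. - c_grad z) z0 x" and M: "fst z0 ** snd z0 = M"
  shows "flattening_on (mf_f M) {0..} x"
  unfolding flattening_on_def
proof (intro ballI impI)
  fix s t :: real assume st: "s \<in> {0..}" "t \<in> {0..}" "s < t"
  show "flatter_eq (mf_f M) (x t) (x s)"
  proof (rule flatter_eq_mf_f)
    show "fst (x s) ** snd (x s) = M" "fst (x t) ** snd (x t) = M"
      using flow_product_constant[OF sol] M st by auto
    have dec: "mf_phi (x t) \<le> mf_phi (x s)" using flow_mf_phi_decreasing[OF sol] st by simp
    \<comment> \<open>A zero of \<open>mf_phi\<close> persists; while it is positive the Riccati
      estimate makes the decrease strict, so a tie occurs only at zero.\<close>
    consider "mf_phi (x s) = 0" | "mf_phi (x s) > 0" "mf_phi (x t) = 0" | "mf_phi (x s) > 0" "mf_phi (x t) > 0"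
      using mf_phi_nonneg[of "x s"] mf_phi_nonneg[of "x t"] by linarith
    then show "spectral_sq (x t) < spectral_sq (x s) \<or> mf_phi (x s) = 0 \<and> mf_phi (x t) = 0"
    proof cases
      case 1
      then show ?thesis using dec mf_phi_nonneg[of "x t"] by simp
    next
      case 2
      then show ?thesis using st by (simp add: flow_mf_phi[OF sol])
    next
      case 3
      then have "1 / mf_phi (x s) < 1 / mf_phi (x t)"
        using flow_mf_phi_riccati[OF sol, of s t] st by simp
      then have "mf_phi (x t) < mf_phi (x s)" using 3 by (simp add: divide_less_cancel field_simps)
      then show ?thesis using st by (simp add: flow_mf_phi[OF sol])
    qed
  qed
qed

lemma isCont_c_grad: "isCont c_grad z"
proof -
  obtain L where "L-lipschitz_on (ball z 1) c_grad" using lipschitz_on_c_grad[OF bounded_ball] by blast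
  then have "continuous_on (ball z 1) c_grad" by (rule lipschitz_on_continuous_on)
  then show ?thesis by (simp add: continuous_on_eq_continuous_at)
qed

text \<open>The limit is an equilibrium, and the constant product passes to it, so f vanishes
  there.\<close>

lemma flow_converges:
  fixes x :: "real \<Rightarrow> (real^'r^'m) \<times> (real^'n^'r)"
  assumes sol: "global_solution (\<lambda>z. - c_grad z) z0 x" and M: "fst z0 ** snd z0 = M"
  shows "\<exists>l. (x \<longlongrightarrow> l) at_top \<and> balanced l \<and> (\<forall>z. mf_f M l \<le> mf_f M z)"
proof -
  obtain k where k: "k > 0" "\<And>z :: (real^'r^'m) \<times> (real^'n^'r). k * mf_c z powr (3/4) \<le> norm (c_grad z)"
    using lojasiewicz_mf_c by blast
  obtain l where l: "(x \<longlongrightarrow> l) at_top"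
    using lojasiewicz_flow_converges[OF sol gderiv_mf_c k mf_c_nonneg] c_grad_eq_0_iff mf_c_eq_0_iff by blast
  have "- c_grad l = 0"
    by (rule global_solution_limit_equilibrium[OF sol l]) (intro continuous_intros isCont_c_grad)
  then have "balanced l" by (simp add: balanced_iff_imbalance c_grad_eq_0_iff)
  moreover have "fst l ** snd l = M"
  proof (rule tendsto_unique)
    show "((\<lambda>t. fst (x t) ** snd (x t)) \<longlongrightarrow> fst l ** snd l) at_top"
      by (intro mul.tendsto tendsto_fst tendsto_snd l)
    have "\<forall>\<^sub>F t in at_top. fst (x t) ** snd (x t) = M"
      using flow_product_constant[OF sol] M by (intro eventually_mono[OF eventually_ge_at_top[of 0]]) simp
    then show "((\<lambda>t. fst (x t) ** snd (x t)) \<longlongrightarrow> M) at_top" by (rule tendsto_eventually)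
  qed simp
  then have "mf_f M l = 0" by (simp add: mf_f_inner)
  then have "\<forall>z. mf_f M l \<le> mf_f M z" by (simp add: mf_f_nonneg)
  ultimately show ?thesis using l by blast
qed

lemma flow_lambda1:
  assumes sol: "global_solution (\<lambda>z. - c_grad z) z0 x" and M: "fst z0 ** snd z0 = M" and "t \<ge> 0"
  shows "lambda1 (hessian (mf_f M) (x t)) = spectral_sq (x t)"
  using flow_product_constant[OF sol \<open>t \<ge> 0\<close>] M by (intro lambda1_hessian_mf_f) simp

lemma flow_lambda1_right:
  fixes x :: "real \<Rightarrow> (real^'r^'m) \<times> (real^'n^'r)"
  assumes sol: "global_solution (\<lambda>z. - c_grad z) z0 x" and M: "fst z0 ** snd z0 = M" and t: "t \<ge> 0"
  shows "\<exists>d. ((\<lambda>t. lambda1 (hessian (mf_f M) (x t))) has_real_derivative d) (at_right t)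
    \<and> d \<le> - (lambda1 (hessian (mf_f M) (x t)) - 2 * spectral_norm M)\<^sup>2"
proof -
  note lam = flow_lambda1[OF sol M]
  obtain d where d: "((\<lambda>t. spectral_sq (x t)) has_real_derivative d) (at_right t)" "d \<le> - (mf_phi (x t))\<^sup>2"
    using flow_spectral_sq_right[OF sol t] .
  have "((\<lambda>t. lambda1 (hessian (mf_f M) (x t))) has_real_derivative d) (at_right t)"
    using d(1) unfolding has_field_derivative_iff
    \<comment> \<open>The eigenvalue is identified with \<open>spectral_sq\<close> at nonnegative
      times, hence to the right of t even when t = 0.\<close>
    by (rule Lim_transform_eventually[OF _ eventually_mono[OF eventually_at_right_less[of t]]])
      (use t in \<open>simp add: lam\<close>)
  then show ?thesis using d(2) t by (auto simp: lam flow_mf_phi[OF sol t] M)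
qed

lemma flow_lambda1_AE:
  fixes x :: "real \<Rightarrow> (real^'r^'m) \<times> (real^'n^'r)"
  assumes sol: "global_solution (\<lambda>z. - c_grad z) z0 x" and M: "fst z0 ** snd z0 = M"
  shows "AE t in lebesgue. t > 0 \<longrightarrow> (\<exists>d. ((\<lambda>t. lambda1 (hessian (mf_f M) (x t))) has_real_derivative d) (at t)
    \<and> d \<le> - (lambda1 (hessian (mf_f M) (x t)) - 2 * spectral_norm M)\<^sup>2)"
proof -
  let ?s = "\<lambda>t. spectral_sq (x t)"
  define N where "N = {t. (\<exists>l. (?s has_real_derivative l) (at_left t)) \<and>
    (\<exists>r. (?s has_real_derivative r) (at_right t)) \<and> \<not> (\<exists>d. (?s has_real_derivative d) (at t))}"
  have "N \<in> null_sets lebesgue"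
    unfolding N_def
    by (intro null_sets_completionI countable_imp_null_set_lborel countable_one_sided_not_differentiable)
  from AE_not_in[OF this] show ?thesis
  proof eventually_elim
    case (elim t)
    show ?case
    proof
      assume t: "t > 0"
      obtain r where r: "(?s has_real_derivative r) (at_right t)" "r \<le> - (mf_phi (x t))\<^sup>2"
        using flow_spectral_sq_right[OF sol less_imp_le[OF t]] .
      obtain d where d: "(?s has_real_derivative d) (at t)"
        using elim r flow_spectral_sq_left[OF sol t] unfolding N_def by blast
      then have "(?s has_real_derivative d) (at_right t)" by (rule has_field_derivative_at_within)
      then have "d = r"
        using r(1) unfolding has_field_derivative_iff by (intro tendsto_unique[OF trivial_limit_at_right_real])
      have "((\<lambda>t. lambda1 (hessian (mf_f M) (x t))) has_real_derivative d) (at t)"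
        using d by (rule has_field_derivative_transform_within_open[of _ _ _ "{0<..}"])
          (use t in \<open>auto simp: flow_lambda1[OF sol M]\<close>)
      then show "\<exists>d. ((\<lambda>t. lambda1 (hessian (mf_f M) (x t))) has_real_derivative d) (at t)
        \<and> d \<le> - (lambda1 (hessian (mf_f M) (x t)) - 2 * spectral_norm M)\<^sup>2"
        using r(2) t by (intro exI[of _ d]) (simp add: \<open>d = r\<close> flow_lambda1[OF sol M] flow_mf_phi[OF sol] M)
    qed
  qed
qed

text \<open>The eigenvalue may have corners in time, so its differential inequality is given twice:
  for the right derivative at every t \<ge> 0, and for the ordinary derivative at almost every t >
  0.\<close>

theorem proposition4p32:
  fixes M :: "real^'n^'m"
  defines "f \<equiv> (mf_f M :: (real^'r^'m) \<times> (real^'n^'r) \<Rightarrow> real)"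
    and "c \<equiv> (mf_c :: (real^'r^'m) \<times> (real^'n^'r) \<Rightarrow> real)"
    and "\<phi> \<equiv> (mf_phi :: (real^'r^'m) \<times> (real^'n^'r) \<Rightarrow> real)"
  shows "coercive (\<lambda>z. f z + c z)
    \<and> (\<forall>X Y. X ** Y = M \<longrightarrow> (grad c (X, Y) = 0 \<longleftrightarrow> transpose X ** X = Y ** transpose Y))
    \<and> (\<forall>z. \<exists>d. has_dir_deriv \<phi> z (- grad c z) d \<and> d \<le> - (\<phi> z)\<^sup>2)
    \<and> (\<forall>X0 Y0. X0 ** Y0 = M \<longrightarrow>
         (\<exists>x. global_solution (\<lambda>z. - grad c z) (X0, Y0) x
            \<and> (\<forall>y. global_solution (\<lambda>z. - grad c z) (X0, Y0) y \<longrightarrow> (\<forall>t\<ge>0. y t = x t))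
            \<and> flattening_on f {0..} x
            \<and> (\<exists>l. (x \<longlongrightarrow> l) at_top \<and> balanced l \<and> (\<forall>z. f l \<le> f z))
            \<and> (\<forall>t\<ge>0. \<exists>d. ((\<lambda>t. lambda1 (hessian f (x t))) has_real_derivative d) (at_right t)
                 \<and> d \<le> - (lambda1 (hessian f (x t)) - 2 * spectral_norm M)\<^sup>2)
            \<and> (AE t in lebesgue. t > 0 \<longrightarrow>
                 (\<exists>d. ((\<lambda>t. lambda1 (hessian f (x t))) has_real_derivative d) (at t)
                    \<and> d \<le> - (lambda1 (hessian f (x t)) - 2 * spectral_norm M)\<^sup>2))
            \<and> (\<forall>t>0. lambda1 (hessian f (x t)) \<le> 2 * spectral_norm M + 1 / t)))"
  unfolding f_def c_def \<phi>_def grad_mf_c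
proof (intro conjI allI impI)
  show "coercive (\<lambda>z :: (real^'r^'m) \<times> (real^'n^'r). mf_f M z + mf_c z)"
    by (rule coercive_mf_f_plus_mf_c)
  show "c_grad (X, Y) = 0 \<longleftrightarrow> transpose X ** X = Y ** transpose Y" for X :: "real^'r^'m" and Y :: "real^'n^'r"
    by (simp add: c_grad_eq_0_iff imbalance_def)
  show "\<exists>d. has_dir_deriv mf_phi z (- c_grad z) d \<and> d \<le> - (mf_phi z)\<^sup>2" for z :: "(real^'r^'m) \<times> (real^'n^'r)"
    using mf_phi_dir_deriv_c_grad by blast
  fix X0 :: "real^'r^'m" and Y0 :: "real^'n^'r" assume "X0 ** Y0 = M"
  then have M: "fst (X0, Y0) ** snd (X0, Y0) = M" by simp
  obtain x where x: "global_solution (\<lambda>z. - c_grad z) (X0, Y0) x" by (rule flow_exists)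
  have "lambda1 (hessian (mf_f M) (x t)) \<le> 2 * spectral_norm M + 1 / t" if "t > 0" for t
    using flow_mf_phi_le[OF x that] flow_mf_phi[OF x, of t] flow_lambda1[OF x M, of t] that M by simp
  with x flow_unique[OF x] flow_flattening[OF x M] flow_converges[OF x M] flow_lambda1_right[OF x M] flow_lambda1_AE[OF x M]
  show "\<exists>x. global_solution (\<lambda>z. - c_grad z) (X0, Y0) x
            \<and> (\<forall>y. global_solution (\<lambda>z. - c_grad z) (X0, Y0) y \<longrightarrow> (\<forall>t\<ge>0. y t = x t))
            \<and> flattening_on (mf_f M) {0..} x
            \<and> (\<exists>l. (x \<longlongrightarrow> l) at_top \<and> balanced l \<and> (\<forall>z. mf_f M l \<le> mf_f M z))
            \<and> (\<forall>t\<ge>0. \<exists>d. ((\<lambda>t. lambda1 (hessian (mf_f M) (x t))) has_real_derivative d) (at_right t)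
                 \<and> d \<le> - (lambda1 (hessian (mf_f M) (x t)) - 2 * spectral_norm M)\<^sup>2)
            \<and> (AE t in lebesgue. t > 0 \<longrightarrow>
                 (\<exists>d. ((\<lambda>t. lambda1 (hessian (mf_f M) (x t))) has_real_derivative d) (at t)
                    \<and> d \<le> - (lambda1 (hessian (mf_f M) (x t)) - 2 * spectral_norm M)\<^sup>2))
            \<and> (\<forall>t>0. lambda1 (hessian (mf_f M) (x t)) \<le> 2 * spectral_norm M + 1 / t)"
    by (intro exI[of _ x] conjI allI impI)
qed

end
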